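(* Let $p$ be a prime and let $G$ be a finite non-abelian $p$-group. Then $$\mathsf D(G)\leq \frac{p^2+2p-2}{p^3}|G|.$$
   Context: A sequence over a finite group $G$ is a finite unordered list of elements of $G$ with repetition allowed; its length is its number of terms with multiplicity. It is product-one if its terms can be ordered so that their product is the identity. A minimal product-one sequence is a nonempty product-one sequence that cannot be partitioned into two nonempty product-one subsequences. $\mathsf D(G)$ (the large Davenport constant) is the maximal length of a minimal product-one sequence over $G$. *)

theory Defs
  imports "HOL-Algebra.Algebra" "HOL-Library.Multiset" "HOL-Computational_Algebra.Primes"
begin

definition sequence_over :: "('a, 'b) monoid_scheme \<Rightarrow> 'a multiset \<Rightarrow> bool" where
  "sequence_over G S \<longleftrightarrow> set_mset S \<subseteq> carrier G"

definition product_one :: "('a, 'b) monoid_scheme \<Rightarrow> 'a multiset \<Rightarrow> bool" where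
  "product_one G S \<longleftrightarrow> sequence_over G S \<and>
     (\<exists>xs. mset xs = S \<and> foldr (\<otimes>\<^bsub>G\<^esub>) xs \<one>\<^bsub>G\<^esub> = \<one>\<^bsub>G\<^esub>)"

definition minimal_product_one :: "('a, 'b) monoid_scheme \<Rightarrow> 'a multiset \<Rightarrow> bool" where
  "minimal_product_one G S \<longleftrightarrow> S \<noteq> {#} \<and> product_one G S \<and>
     \<not> (\<exists>T U. S = T + U \<and> T \<noteq> {#} \<and> U \<noteq> {#} \<and> product_one G T \<and> product_one G U)"

text \<open>For a finite group the set of lengths is finite and nonempty (see
  \<open>finite_minimal_product_one_lengths\<close> and \<open>minimal_product_one_lengths_nonempty\<close> below),
  so \<^const>\<open>Max\<close> is the genuine maximum.\<close>

definition large_davenport :: "('a, 'b) monoid_scheme \<Rightarrow> nat" where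
  "large_davenport G = Max {size S | S. minimal_product_one G S}"

definition finite_p_group :: "nat \<Rightarrow> ('a, 'b) monoid_scheme \<Rightarrow> bool" where
  "finite_p_group p G \<longleftrightarrow> group G \<and> finite (carrier G) \<and> (\<exists>n. order G = p ^ n)"

lemma (in group) foldr_mult_append:
  assumes "set xs \<subseteq> carrier G" "set ys \<subseteq> carrier G"
  shows "foldr (\<otimes>) (xs @ ys) \<one> = foldr (\<otimes>) xs \<one> \<otimes> foldr (\<otimes>) ys \<one>"
  using assms by (induction xs) (auto simp: m_assoc)

lemma (in group) minimal_product_one_size_le_order:
  assumes fin: "finite (carrier G)" and min: "minimal_product_one G S"
  shows "size S \<le> order G"
proof (rule ccontr)
  assume gt: "\<not> size S \<le> order G"
  let ?P = "\<lambda>xs. foldr (\<otimes>) xs \<one>"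
  obtain xs where xs: "mset xs = S" "?P xs = \<one>"
    using min by (auto simp: minimal_product_one_def product_one_def)
  have sub: "set xs \<subseteq> carrier G"
    using min xs(1)
    by (auto simp: minimal_product_one_def product_one_def sequence_over_def)
  have len: "length xs = size S" using xs(1) by auto
  let ?f = "\<lambda>i. ?P (take i xs)"
  have "?f ` {..<length xs} \<subseteq> carrier G"
    using sub by (auto intro!: multlist_closed dest: in_set_takeD)
  then have "card (?f ` {..<length xs}) \<le> order G"
    unfolding order_def by (rule card_mono[OF fin])
  then have "\<not> inj_on ?f {..<length xs}"
    using gt len by (auto dest!: card_image)
  then obtain i j where ij: "i < j" "j < length xs" "?f i = ?f j"
    unfolding inj_on_def by (metis lessThan_iff linorder_neqE_nat)
  define a b c where "a = take i xs" and "b = drop i (take j xs)" and "c = drop j xs"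
  have ab: "a @ b = take j xs"
    using ij(1) unfolding a_def b_def
    by (metis append_take_drop_id less_imp_le min.absorb1 take_take)
  have abc: "xs = a @ b @ c"
    using ab unfolding c_def by (metis append.assoc append_take_drop_id)
  have cl: "set a \<subseteq> carrier G" "set b \<subseteq> carrier G" "set c \<subseteq> carrier G"
    using sub abc by auto
  then have P: "?P a \<in> carrier G" "?P b \<in> carrier G" "?P c \<in> carrier G"
    by (auto intro!: multlist_closed)
  have "?P a \<otimes> ?P b = ?P a"
    using ij(3) ab cl foldr_mult_append[of a b] by (simp add: a_def)
  then have b1: "?P b = \<one>" using P by simp
  have "?P xs = ?P a \<otimes> (?P b \<otimes> ?P c)"
    using cl by (simp add: abc foldr_mult_append del: foldr_append)
  then have ac1: "?P (a @ c) = \<one>"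
    using xs(2) b1 P cl by (simp add: foldr_mult_append del: foldr_append)
  have "product_one G (mset b)"
    using b1 cl(2) unfolding product_one_def sequence_over_def by auto
  moreover have "product_one G (mset (a @ c))"
    unfolding product_one_def sequence_over_def
    using cl ac1 by (intro conjI exI[of _ "a @ c"]) auto
  moreover have "S = mset b + mset (a @ c)"
    using xs(1) abc by (simp add: ac_simps)
  moreover have "mset b \<noteq> {#}" "mset (a @ c) \<noteq> {#}"
    using ij by (auto simp: b_def c_def)
  ultimately show False
    using min unfolding minimal_product_one_def by blast
qed

lemma (in group) finite_minimal_product_one_lengths:
  assumes "finite (carrier G)"
  shows "finite {size S | S. minimal_product_one G S}"
  by (rule finite_subset[of _ "{..order G}"])
    (use minimal_product_one_size_le_order[OF assms] in auto)

lemma (in group) minimal_product_one_lengths_nonempty: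
  "{size S | S. minimal_product_one G S} \<noteq> {}"
proof -
  have "product_one G {#\<one>#}"
    unfolding product_one_def sequence_over_def
    by (auto intro!: exI[of _ "[\<one>]"])
  then have "minimal_product_one G {#\<one>#}"
    unfolding minimal_product_one_def by (auto simp: union_is_single single_is_union)
  then show ?thesis by blast
qed

end

theory Submission
  imports Defs "HOL-Number_Theory.Residues"
begin

text \<open>In a non-abelian \<open>p\<close>-group there are \<open>x\<close> and \<open>y\<close> whose commutator \<open>c\<close> is central of order \<open>p\<close>. Let
  \<open>H = \<langle>x, y\<rangle>\<close>, with centre \<open>Z\<close> of order \<open>q\<close>, so that \<open>H / Z\<close> is \<open>(\<int>/p)\<^sup>2\<close>. As
  \<open>D(G) \<le> [G : H] D(H)\<close> and \<open>q \<ge> p\<close>, it suffices to show \<open>D(H) \<le> p q + 2 p - 2\<close>.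

  Every sequence over \<open>H\<close> of length \<open>p q + p - 1\<close> has a non-empty product-one subsequence: since
  \<open>3 p - 2\<close> elements of \<open>(\<int>/p)\<^sup>2\<close> have a non-empty zero-sum subsequence of length at most \<open>p\<close>, it contains
  \<open>q\<close> disjoint blocks with products in \<open>Z\<close>. Now let \<open>S\<close> be a minimal product-one sequence of length at
  least \<open>p q + 2 p - 1\<close>. It has fewer than \<open>q\<close> terms in \<open>Z\<close>, so \<open>p - 1\<close> of the other terms lie on one of
  the \<open>p + 1\<close> lines of \<open>H / Z\<close>. Together with a term off that line they form a sequence \<open>T\<close> of length \<open>p\<close>
  whose products fill a coset of \<open>\<langle>c\<rangle>\<close>. The rest of \<open>S\<close> contains a product-one sequence, and
  reordering \<open>T\<close> makes its complement in \<open>S\<close> product-one as well, a contradiction.\<close>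

section \<open>Zero-sum subsequences modulo a prime\<close>

text \<open>Functions of a multiset that are polynomials of degree less than \<open>n\<close>.\<close>

fun vanishing_differences :: "nat \<Rightarrow> ('a multiset \<Rightarrow> int) \<Rightarrow> bool" where
  "vanishing_differences 0 F \<longleftrightarrow> (\<forall>T. F T = 0)"
| "vanishing_differences (Suc n) F \<longleftrightarrow>
     (\<forall>a. vanishing_differences n (\<lambda>T. F T - F (add_mset a T)))"

lemma vanishing_differences_diff:
  "vanishing_differences n F \<Longrightarrow> vanishing_differences n E \<Longrightarrow>
     vanishing_differences n (\<lambda>T. F T - E T)"
proof (induction n arbitrary: F E)
  case (Suc n)
  have "vanishing_differences n (\<lambda>T. (F T - F (add_mset a T)) - (E T - E (add_mset a T)))" for a
    using Suc.prems Suc.IH[of "\<lambda>T. F T - F (add_mset a T)" "\<lambda>T. E T - E (add_mset a T)"] by auto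
  then show ?case by (simp add: algebra_simps)
qed simp

lemma vanishing_differences_cmult:
  "vanishing_differences n F \<Longrightarrow> vanishing_differences n (\<lambda>T. k * F T)"
proof (induction n arbitrary: F)
  case (Suc n)
  then have "vanishing_differences n (\<lambda>T. k * (F T - F (add_mset a T)))" for a
    by (intro Suc.IH) auto
  then show ?case by (simp add: algebra_simps)
qed simp

lemma vanishing_differences_Suc:
  "vanishing_differences n F \<Longrightarrow> vanishing_differences (Suc n) F"
proof (induction n arbitrary: F)
  case (Suc n)
  then have "vanishing_differences (Suc n) (\<lambda>T. F T - F (add_mset a T))" for a
    by (metis vanishing_differences.simps(2))
  then show ?case by (metis vanishing_differences.simps(2))
qed simp

lemma vanishing_differences_mono:
  assumes "vanishing_differences n F" "n \<le> m" shows "vanishing_differences m F"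
  using assms(2,1) by (induction rule: dec_induct) (simp_all only: vanishing_differences_Suc)

lemma vanishing_differences_translate:
  "vanishing_differences n F \<Longrightarrow> vanishing_differences n (\<lambda>T. F (add_mset a T))"
proof (induction n arbitrary: F)
  case (Suc n)
  then have "vanishing_differences n (\<lambda>T. F (add_mset a T) - F (add_mset b (add_mset a T)))" for b
    using Suc.IH[of "\<lambda>T. F T - F (add_mset b T)"] by auto
  then show ?case by (simp add: add_mset_commute)
qed simp

text \<open>The discrete Leibniz rule: the difference of the product is the additive function times
  the difference of \<open>F\<close>, minus \<open>f a\<close> times a translate of
  \<open>F\<close>. Hence the degree grows by at most one.\<close>

lemma vanishing_differences_mult_linear:
  "vanishing_differences n F \<Longrightarrow>
     vanishing_differences (Suc n) (\<lambda>T. (\<Sum>x\<in>#T. f x) * F T)"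
proof (induction n arbitrary: F)
  case (Suc n)
  show ?case
  proof (subst vanishing_differences.simps, rule allI)
    fix a
    have "vanishing_differences n (\<lambda>T. F T - F (add_mset a T))"
      using Suc.prems by simp
    then have "vanishing_differences (Suc n)
        (\<lambda>T. (\<Sum>x\<in>#T. f x) * (F T - F (add_mset a T)) - f a * F (add_mset a T))"
      using Suc by (intro vanishing_differences_diff vanishing_differences_cmult
          vanishing_differences_translate)
    then show "vanishing_differences (Suc n)
        (\<lambda>T. (\<Sum>x\<in>#T. f x) * F T - (\<Sum>x\<in>#add_mset a T. f x) * F (add_mset a T))"
      by (simp add: algebra_simps)
  qed
qed simp

lemma vanishing_differences_mult_linear_power:
  "vanishing_differences n F \<Longrightarrow>
     vanishing_differences (n + k) (\<lambda>T. (\<Sum>x\<in>#T. f x) ^ k * F T)"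
proof (induction k)
  case (Suc k)
  then show ?case
    using vanishing_differences_mult_linear[of "n + k" "\<lambda>T. (\<Sum>x\<in>#T. f x) ^ k * F T" f]
    by (simp add: mult.assoc)
qed simp

text \<open>By Fermat's little theorem a factor is, modulo a prime \<open>p\<close>, 1 if the sum of
  \<open>f\<close> over \<open>T\<close> vanishes and 0 otherwise. Modulo \<open>p\<close> the
  product is thus the indicator of the sequences on which all of \<open>fs\<close> sum to
  zero.\<close>

definition zero_sum_indicator :: "nat \<Rightarrow> ('a \<Rightarrow> int) list \<Rightarrow> 'a multiset \<Rightarrow> int" where
  "zero_sum_indicator p fs T = (\<Prod>f\<leftarrow>fs. 1 - (\<Sum>x\<in>#T. f x) ^ (p - 1))"

lemma vanishing_differences_zero_sum_indicator:
  "vanishing_differences (length fs * (p - 1) + 1) (zero_sum_indicator p fs)"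
proof (induction fs)
  case Nil
  then show ?case by (simp add: zero_sum_indicator_def)
next
  case (Cons f fs)
  let ?n = "length fs * (p - 1) + 1"
  have "vanishing_differences (?n + (p - 1)) (\<lambda>T. zero_sum_indicator p fs T
      - (\<Sum>x\<in>#T. f x) ^ (p - 1) * zero_sum_indicator p fs T)"
    using Cons by (intro vanishing_differences_diff vanishing_differences_mult_linear_power)
      (auto intro: vanishing_differences_mono)
  moreover have "?n + (p - 1) = length (f # fs) * (p - 1) + 1" by simp
  moreover have "(\<lambda>T. zero_sum_indicator p fs T
      - (\<Sum>x\<in>#T. f x) ^ (p - 1) * zero_sum_indicator p fs T) = zero_sum_indicator p (f # fs)"
    by (simp add: zero_sum_indicator_def fun_eq_iff algebra_simps)
  ultimately show ?case by metis
qed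

lemma zero_sum_indicator_cong_0:
  assumes p: "Factorial_Ring.prime p" and f: "f \<in> set fs" "\<not> int p dvd (\<Sum>x\<in>#T. f x)"
  shows "int p dvd zero_sum_indicator p fs T"
proof -
  let ?s = "\<Sum>x\<in>#T. f x"
  have "coprime ?s (int p)"
    using p f(2) prime_imp_coprime[of "int p" ?s] by (simp add: coprime_commute)
  then have "[?s ^ totient p = 1] (mod int p)"
    using p prime_gt_1_nat[of p] residues.euler_theorem[of "int p" ?s]
    by (simp add: residues_def)
  then have "int p dvd 1 - ?s ^ (p - 1)"
    using p by (simp add: totient_prime cong_iff_dvd_diff dvd_diff_commute)
  moreover have "1 - ?s ^ (p - 1) dvd zero_sum_indicator p fs T"
    unfolding zero_sum_indicator_def using f(1) by (intro prod_list_dvd) auto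
  ultimately show ?thesis by (rule dvd_trans)
qed

text \<open>Unfolded, this is the alternating sum of \<open>F (T + B)\<close> over the subsequences
  \<open>B\<close> of \<open>as\<close>, with sign given by the parity of
  \<open>size B\<close>.\<close>

fun iterated_difference :: "'a list \<Rightarrow> ('a multiset \<Rightarrow> int) \<Rightarrow> 'a multiset \<Rightarrow> int" where
  "iterated_difference [] F T = F T"
| "iterated_difference (a # as) F T =
     iterated_difference as F T - iterated_difference as F (add_mset a T)"

text \<open>Differences commute, so the outermost one can be moved inside \<open>F\<close>, where
  the recursion of \<open>vanishing_differences\<close> takes it.\<close>

lemma iterated_difference_diff:
  "iterated_difference as (\<lambda>T. F T - F (add_mset a T)) T =
   iterated_difference as F T - iterated_difference as F (add_mset a T)"
  by (induction as arbitrary: T) (auto simp: add_mset_commute)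

lemma iterated_difference_eq_0:
  "vanishing_differences (length as) F \<Longrightarrow> iterated_difference as F T = 0"
proof (induction as arbitrary: F T)
  case (Cons a as)
  then have "iterated_difference as (\<lambda>T. F T - F (add_mset a T)) T = 0"
    by (intro Cons.IH) simp
  then show ?case by (simp add: iterated_difference_diff)
qed simp

text \<open>In the alternating sum every summand but the one of the empty subsequence is a multiple
  of \<open>m\<close>.\<close>

lemma iterated_difference_cong:
  fixes m :: int
  assumes "\<And>T. T \<subseteq># mset as \<Longrightarrow> T \<noteq> {#} \<Longrightarrow> m dvd F (U + T)"
  shows "m dvd iterated_difference as F U - F U"
  using assms
proof (induction as arbitrary: U)
  case (Cons a as)
  have "m dvd iterated_difference as F U - F U"
    using Cons.prems by (intro Cons.IH) (simp add: subset_mset.le_supI2 subset_mset.trans[of _ "mset as"])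
  moreover have "m dvd iterated_difference as F (add_mset a U) - F (add_mset a U)"
  proof (rule Cons.IH)
    fix T assume "T \<subseteq># mset as" "T \<noteq> {#}"
    then show "m dvd F (add_mset a U + T)" using Cons.prems[of "add_mset a T"] by simp
  qed
  moreover have "m dvd F (add_mset a U)"
    using Cons.prems[of "{#a#}"] by simp
  ultimately have "m dvd (iterated_difference as F U - F U)
      - (iterated_difference as F (add_mset a U) - F (add_mset a U)) - F (add_mset a U)"
    by (metis dvd_diff)
  then show ?case by (simp add: algebra_simps)
qed simp

text \<open>Olson's theorem for elementary abelian \<open>p\<close>-groups: the indicator of the zero-sum subsequences
  is, modulo \<open>p\<close>, a polynomial of degree \<open>r (p - 1)\<close>, so its differences of higher order vanish, which
  is impossible if it is supported on the empty sequence alone.\<close>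

theorem exists_zero_sum:
  assumes p: "Factorial_Ring.prime p" and size: "size M > length fs * (p - 1)"
  obtains T where "T \<subseteq># M" "T \<noteq> {#}" "\<And>f. f \<in> set fs \<Longrightarrow> int p dvd (\<Sum>x\<in>#T. f x)"
proof -
  obtain as where as: "mset as = M" using ex_mset by blast
  have "\<exists>T. T \<subseteq># M \<and> T \<noteq> {#} \<and> (\<forall>f\<in>set fs. int p dvd (\<Sum>x\<in>#T. f x))"
  proof (rule ccontr)
    assume "\<not> ?thesis"
    then have "int p dvd zero_sum_indicator p fs ({#} + T)" if "T \<subseteq># mset as" "T \<noteq> {#}" for T
      using that as zero_sum_indicator_cong_0[OF p] by auto
    then have "int p dvd iterated_difference as (zero_sum_indicator p fs) {#}
        - zero_sum_indicator p fs {#}"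
      by (rule iterated_difference_cong)
    moreover have "iterated_difference as (zero_sum_indicator p fs) {#} = 0"
      using size as
      by (intro iterated_difference_eq_0
          vanishing_differences_mono[OF vanishing_differences_zero_sum_indicator]) auto
    moreover have "zero_sum_indicator p fs {#} = 1"
      using prime_gt_1_nat[OF p] by (induction fs) (auto simp: zero_sum_indicator_def)
    ultimately show False using prime_gt_1_nat[OF p] by simp
  qed
  then show ?thesis using that by blast
qed

lemma exists_subset_mset_size:
  "n \<le> size M \<Longrightarrow> \<exists>T. T \<subseteq># M \<and> size T = n"
proof (induction M arbitrary: n)
  case (add x M)
  show ?case
  proof (cases "n \<le> size M")
    case True
    then show ?thesis using add.IH by (metis add_mset_add_single mset_subset_eq_add_left subset_mset.trans)
  next
    case False
    then show ?thesis using add.prems by (intro exI[of _ "add_mset x M"]) auto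
  qed
qed simp

text \<open>The third coordinate \<open>1\<close> forces the length of a zero-sum subsequence to be \<open>p\<close> or \<open>2 p\<close>; in the
  latter case it splits, as \<open>2 p - 1\<close> terms already contain a zero sum.\<close>

lemma exists_short_zero_sum:
  fixes f g :: "'a \<Rightarrow> int"
  assumes p: "Factorial_Ring.prime p" and size: "size M \<ge> 3 * p - 2"
  obtains T where "T \<subseteq># M" "T \<noteq> {#}" "size T \<le> p"
    "int p dvd (\<Sum>x\<in>#T. f x)" "int p dvd (\<Sum>x\<in>#T. g x)"
proof -
  have p1: "p > 1" using prime_gt_1_nat[OF p] .
  obtain M' where M': "M' \<subseteq># M" "size M' = 3 * p - 2"
    using exists_subset_mset_size[OF size] by blast
  obtain T where T: "T \<subseteq># M'" "T \<noteq> {#}"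
    and z: "\<And>h. h \<in> set [f, g, \<lambda>_. 1] \<Longrightarrow> int p dvd (\<Sum>x\<in>#T. h x)"
  proof (rule exists_zero_sum[OF p, of "[f, g, \<lambda>_. 1]" M'])
    show "length [f, g, \<lambda>_. 1] * (p - 1) < size M'" using M'(2) p1 by simp
  qed blast
  have pd: "int p dvd (\<Sum>x\<in>#T. f x)" "int p dvd (\<Sum>x\<in>#T. g x)" "p dvd size T"
    using z[of f] z[of g] z[of "\<lambda>_. 1"] by (simp_all flip: of_nat_sum_mset)
  show ?thesis
  proof (cases "size T \<le> p")
    case True
    then show ?thesis
      using that[of T] T M'(1) pd by (meson subset_mset.trans)
  next
    case False
    obtain k where k: "size T = p * k" using pd(3) by auto
    have "size T \<le> 3 * p - 2" using size_mset_mono[OF T(1)] M'(2) by simp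
    then have "p * k < p * 3" using k p1 by linarith
    moreover have "p * 1 < p * k" using False k by simp
    ultimately have "k = 2" unfolding mult_less_cancel1 by linarith
    then have sT: "size T = 2 * p" using k by simp
    \<comment> \<open>One term is set aside so that \<open>T1\<close>, found among the other
      \<open>2 * p - 1\<close>, is a proper part of \<open>T\<close>. Its complement
      \<open>T2\<close> is then a non-empty zero sum as well, and one of the two has at most
      \<open>p\<close> terms.\<close>
    obtain x where x: "x \<in># T" using T(2) by blast
    have "length [f, g] * (p - 1) < size (T - {#x#})"
      using sT x p1 by (simp add: size_Diff_singleton)
    then obtain T1 where T1: "T1 \<subseteq># T - {#x#}" "T1 \<noteq> {#}"
      and z1: "\<And>h. h \<in> set [f, g] \<Longrightarrow> int p dvd (\<Sum>x\<in>#T1. h x)"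
      by (rule exists_zero_sum[OF p]) blast
    have sub: "T1 \<subseteq># T" using T1(1) by (meson diff_subset_eq_self subset_mset.trans)
    have "size T1 \<le> size (T - {#x#})" using T1(1) by (rule size_mset_mono)
    then have lt: "size T1 < size T" using x by (simp add: size_Diff_singleton sT) (use p1 in linarith)
    define T2 where "T2 = T - T1"
    have T2: "T = T1 + T2" using sub by (simp add: T2_def)
    have ne: "T2 \<noteq> {#}" using lt T2 by auto
    have z2: "int p dvd (\<Sum>x\<in>#T2. f x)" "int p dvd (\<Sum>x\<in>#T2. g x)"
      using pd(1,2) z1[of f] z1[of g] by (simp_all add: T2 dvd_add_right_iff)
    have "size T1 \<le> p \<or> size T2 \<le> p" using sT by (simp add: T2) linarith
    moreover have "T1 \<subseteq># M" "T2 \<subseteq># M"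
      using T(1) M'(1) T2 by (metis mset_subset_eq_add_left mset_subset_eq_add_right subset_mset.trans)+
    ultimately show ?thesis
      using that[of T1] that[of T2] T1(2) ne z1[of f] z1[of g] z2 by auto
  qed
qed

section \<open>Products of sequences and passage to a subgroup\<close>

text \<open>When blocks are replaced by their products, this lifts an ordering of the products to an
  ordering of the blocks.\<close>

lemma exists_preimage_list:
  "mset ts = image_mset f M \<Longrightarrow> \<exists>us. mset us = M \<and> map f us = ts"
proof (induction ts arbitrary: M)
  case (Cons t ts)
  then obtain a M' where "M = add_mset a M'" "t = f a" "mset ts = image_mset f M'"
    by (metis msed_map_invR mset.simps(2))
  with Cons.IH[of M'] show ?case by (metis list.simps(9) mset.simps(2))
qed simp

context group
begin

definition list_prod :: "'a list \<Rightarrow> 'a" where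
  "list_prod xs = foldr (\<otimes>) xs \<one>"

lemma list_prod_simps [simp]:
  "list_prod [] = \<one>" "list_prod (x # xs) = x \<otimes> list_prod xs"
  by (simp_all add: list_prod_def)

lemma list_prod_closed [simp]: "set xs \<subseteq> carrier G \<Longrightarrow> list_prod xs \<in> carrier G"
  by (induction xs) auto

lemma list_prod_in_subgroup:
  assumes "subgroup H G" "set xs \<subseteq> H" shows "list_prod xs \<in> H"
  using assms(2) by (induction xs) (auto simp: subgroup.one_closed[OF assms(1)] subgroup.m_closed[OF assms(1)])

lemma list_prod_append [simp]:
  "set xs \<subseteq> carrier G \<Longrightarrow> set ys \<subseteq> carrier G \<Longrightarrow>
     list_prod (xs @ ys) = list_prod xs \<otimes> list_prod ys"
  by (induction xs) (auto simp: m_assoc)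

lemma list_prod_concat:
  "\<forall>b\<in>set bs. set b \<subseteq> carrier G \<Longrightarrow> list_prod (concat bs) = list_prod (map list_prod bs)"
proof (induction bs)
  case (Cons b bs)
  moreover from Cons.prems have "set (concat bs) \<subseteq> carrier G" by auto
  ultimately show ?case by simp
qed simp

lemma product_one_iff:
  "product_one G S \<longleftrightarrow> set_mset S \<subseteq> carrier G \<and> (\<exists>xs. mset xs = S \<and> list_prod xs = \<one>)"
  by (simp add: product_one_def sequence_over_def list_prod_def)

text \<open>Pigeonhole on prefix products: counting the empty prefix there are more than
  \<open>card Z\<close> of them, all in \<open>Z\<close>, so two coincide and the terms between them
  multiply to the identity.\<close>

lemma exists_consecutive_product_one:
  assumes Z: "subgroup Z G" "finite Z" and zs: "set zs \<subseteq> Z" "length zs \<ge> card Z"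
  obtains us bs vs where "zs = us @ bs @ vs" "bs \<noteq> []" "list_prod bs = \<one>"
proof -
  have ZG: "Z \<subseteq> carrier G" using Z(1) by (rule subgroup.subset)
  let ?f = "\<lambda>i. list_prod (take i zs)"
  have "?f ` {..length zs} \<subseteq> Z"
    using zs(1) by (auto intro!: list_prod_in_subgroup[OF Z(1)] dest: in_set_takeD)
  then have "card (?f ` {..length zs}) \<le> card Z" by (rule card_mono[OF Z(2)])
  then have "\<not> inj_on ?f {..length zs}" using zs(2) by (auto dest!: card_image)
  then obtain i j where ij: "i < j" "j \<le> length zs" "?f i = ?f j"
    unfolding inj_on_def by (metis atMost_iff linorder_neqE_nat)
  define us bs vs where "us = take i zs" and "bs = drop i (take j zs)" and "vs = drop j zs"
  have ub: "us @ bs = take j zs"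
    using ij(1) unfolding us_def bs_def
    by (metis append_take_drop_id less_imp_le min.absorb1 take_take)
  have eq: "zs = us @ bs @ vs"
    using ub unfolding vs_def by (metis append.assoc append_take_drop_id)
  have cl: "set us \<subseteq> carrier G" "set bs \<subseteq> carrier G" using zs(1) ZG eq by auto
  have "list_prod us \<otimes> list_prod bs = list_prod us"
    using ij(3) ub cl by (metis list_prod_append us_def)
  then have "list_prod bs = \<one>" using cl by simp
  moreover have "bs \<noteq> []" using ij by (auto simp: bs_def)
  ultimately show ?thesis using eq that by blast
qed

section \<open>Cutting product-one sequences into blocks over a subgroup\<close>

text \<open>Cut \<open>xs\<close> after every non-empty prefix whose product lies in
  \<open>H\<close>; the product of a block is then a quotient of two elements of \<open>H\<close>.
  The rest \<open>r\<close> is what follows the last cut.\<close>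

lemma exists_block_decomposition:
  assumes H: "subgroup H G" and xs: "set xs \<subseteq> carrier G"
  shows "\<exists>bs r. concat bs @ r = xs \<and> (\<forall>b\<in>set bs. b \<noteq> [] \<and> list_prod b \<in> H) \<and>
    length bs = card {i \<in> {1..length xs}. list_prod (take i xs) \<in> H} \<and>
    (list_prod xs \<in> H \<longrightarrow> r = [])"
  using xs
proof (induction xs rule: rev_induct)
  case Nil
  show ?case by (intro exI[of _ "[]"]) simp
next
  case (snoc x xs)
  then obtain bs r where IH: "concat bs @ r = xs" "\<And>b. b \<in> set bs \<Longrightarrow> b \<noteq> [] \<and> list_prod b \<in> H"
    "length bs = card {i \<in> {1..length xs}. list_prod (take i xs) \<in> H}"
    by auto
  have cl: "set xs \<subseteq> carrier G" "x \<in> carrier G" using snoc.prems by auto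
  have clc: "set (concat bs) \<subseteq> carrier G" "set r \<subseteq> carrier G"
    using cl(1) unfolding IH(1)[symmetric] by auto
  let ?I = "{i \<in> {1..length xs}. list_prod (take i xs) \<in> H}"
  let ?J = "{i \<in> {1..length (xs @ [x])}. list_prod (take i (xs @ [x])) \<in> H}"
  show ?case
  proof (cases "list_prod (xs @ [x]) \<in> H")
    case True
    have "?J = insert (Suc (length xs)) ?I"
      using True by (auto simp: le_Suc_eq)
    then have J: "card ?J = Suc (card ?I)" by simp
    have "set (map list_prod bs) \<subseteq> H" using IH(2) by auto
    then have cH: "list_prod (concat bs) \<in> H"
      using clc(1) list_prod_in_subgroup[OF H] by (subst list_prod_concat) auto
    have "list_prod (xs @ [x]) = list_prod (concat bs) \<otimes> list_prod (r @ [x])"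
      using clc cl unfolding IH(1)[symmetric] by (simp add: m_assoc del: set_concat)
    then have "list_prod (r @ [x]) = inv (list_prod (concat bs)) \<otimes> list_prod (xs @ [x])"
      using clc cl by (simp add: inv_solve_left del: set_concat)
    then have "list_prod (r @ [x]) \<in> H"
      using True cH H by (simp add: subgroup.m_closed subgroup.m_inv_closed)
    then show ?thesis
      using IH J by (intro exI[of _ "bs @ [r @ [x]]"] exI[of _ "[]"]) auto
  next
    case False
    then have "?J = ?I" by (auto simp: le_Suc_eq)
    then show ?thesis
      using IH False by (intro exI[of _ bs] exI[of _ "r @ [x]"]) auto
  qed
qed

text \<open>Blocks arranged as their products are concatenate to an ordering with product one. This
  turns a splitting of the sequence of block products into a splitting of the underlying
  sequence.\<close>

lemma product_one_concat:
  assumes "set_mset B \<subseteq> {b. set b \<subseteq> carrier G \<and> b \<noteq> []}"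
    and "product_one G (image_mset list_prod B)" "B \<noteq> {#}"
  shows "product_one G (\<Sum>b\<in>#B. mset b)" "(\<Sum>b\<in>#B. mset b) \<noteq> {#}"
proof -
  obtain ts where ts: "mset ts = image_mset list_prod B" "list_prod ts = \<one>"
    using assms(2) by (auto simp: product_one_iff)
  obtain us where us: "mset us = B" "map list_prod us = ts"
    using exists_preimage_list[OF ts(1)] by blast
  have cl: "\<forall>b\<in>set us. set b \<subseteq> carrier G" and ne: "\<forall>b\<in>set us. b \<noteq> []"
    using assms(1) us(1) by auto
  have m: "mset (concat us) = (\<Sum>b\<in>#B. mset b)"
    using us(1) by (auto simp: mset_concat simp flip: sum_mset_sum_list)
  have "list_prod (concat us) = \<one>" using list_prod_concat[OF cl] us(2) ts(2) by simp
  then show "product_one G (\<Sum>b\<in>#B. mset b)"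
    using m cl unfolding product_one_iff by (metis UN_least set_concat set_mset_mset)
  show "(\<Sum>b\<in>#B. mset b) \<noteq> {#}"
    using assms(1,3) by fastforce
qed

text \<open>Otherwise more than \<open>k\<close> prefix products of a product-one ordering of
  \<open>S\<close> lie in one left coset of \<open>H\<close>. Rotating the ordering moves this coset
  to \<open>H\<close>, and cutting there yields more than \<open>k\<close> blocks with products in
  \<open>H\<close>. These products form a product-one sequence too long to be minimal, and its
  splitting splits \<open>S\<close>.\<close>

lemma minimal_product_one_size_le_index:
  assumes fin: "finite (carrier G)" and H: "subgroup H G"
    and bound: "\<And>M. minimal_product_one G M \<Longrightarrow> set_mset M \<subseteq> H \<Longrightarrow> size M \<le> k"
    and S: "minimal_product_one G S"
  shows "size S \<le> card (rcosets H) * k"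
proof (rule ccontr)
  assume gt: "\<not> size S \<le> card (rcosets H) * k"
  obtain xs where xs: "mset xs = S" "list_prod xs = \<one>" "set xs \<subseteq> carrier G"
    using S by (force simp: minimal_product_one_def product_one_iff)
  define n where "n = length xs"
  have n: "n = size S" using xs(1) by (auto simp: n_def)
  define P where "P i = list_prod (take i xs)" for i
  have P [simp]: "P i \<in> carrier G" for i
    using xs(3) unfolding P_def by (meson list_prod_closed set_take_subset subset_trans)
  \<comment> \<open>Inversion turns left cosets into right cosets: \<open>P i\<close> and
    \<open>P j\<close> lie in the same left coset of \<open>H\<close> iff their inverses lie in the
    same right coset.\<close>
  define F where "F y = {i \<in> {1..n}. H #> inv (P i) = y}" for y
  have finR: "finite (rcosets H)" using fin H by (simp add: rcosets_finite RCOSETS_def)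
  have "\<exists>y\<in>rcosets H. card (F y) > k"
  proof (rule ccontr)
    assume "\<not> ?thesis"
    then have le: "card (F y) \<le> k" if "y \<in> rcosets H" for y using that by force
    have "{1..n} \<subseteq> (\<Union>y\<in>rcosets H. F y)"
      by (auto simp: F_def intro!: rcosetsI subgroup.subset[OF H])
    then have "n \<le> card (\<Union>y\<in>rcosets H. F y)"
      using card_mono[of "\<Union>y\<in>rcosets H. F y" "{1..n}"] finR by (auto simp: F_def)
    also have "\<dots> \<le> (\<Sum>y\<in>rcosets H. card (F y))" using finR by (rule card_UN_le)
    also have "\<dots> \<le> card (rcosets H) * k" using sum_bounded_above[of "rcosets H" "\<lambda>y. card (F y)" k] le by simp
    finally show False using gt n by simp
  qed
  then obtain y where y: "card (F y) > k" by blast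
  then obtain j where j: "j \<in> F y" by fastforce
  have jn: "1 \<le> j" "j \<le> n" using j by (auto simp: F_def)
  have PH: "inv (P j) \<otimes> P i \<in> H" if "i \<in> F y" for i
  proof -
    have "H #> inv (P i) = H #> inv (P j)" using that j by (simp add: F_def)
    then have "inv (P j) \<in> H #> inv (P i)" using H by (simp add: rcos_self)
    then obtain h where h: "h \<in> H" "inv (P j) = h \<otimes> inv (P i)" by (auto simp: r_coset_def)
    then have "inv (P j) \<otimes> P i = h"
      using subgroup.mem_carrier[OF H h(1)] by (simp add: m_assoc)
    then show ?thesis using h by simp
  qed
  \<comment> \<open>The rotation starts behind the \<open>j\<close>-th term, so its prefix products
    are of the form \<open>inv (P j) \<otimes> P i\<close>.\<close>
  define ys where "ys = drop j xs @ take j xs"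
  have cl: "set (drop j xs) \<subseteq> carrier G" "set (take i xs) \<subseteq> carrier G" for i
    using xs(3) by (meson set_take_subset set_drop_subset subset_trans)+
  have dropP: "list_prod (drop j xs) = inv (P j)"
    using xs(2) cl inv_equality[of "list_prod (drop j xs)" "P j"]
    by (metis P P_def append_take_drop_id inv_comm list_prod_append list_prod_closed)
  have ys: "set ys \<subseteq> carrier G" "list_prod ys = \<one>" "mset ys = S" "length ys = n"
  proof -
    show "set ys \<subseteq> carrier G" unfolding ys_def using cl by simp
    show "list_prod ys = \<one>" using cl P[of j] by (simp add: ys_def dropP) (simp add: P_def)
    have "mset ys = mset (take j xs @ drop j xs)" by (simp only: ys_def mset_append add.commute)
    then show "mset ys = S" using xs(1) by simp
    show "length ys = n" using jn by (simp add: ys_def n_def)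
  qed
  \<comment> \<open>\<open>f i\<close> is the length of the prefix of \<open>ys\<close> that ends
    with the \<open>i\<close>-th term of \<open>xs\<close>. The index \<open>j\<close> itself goes
    to the full length \<open>n\<close> and not to 0, so it counts among the non-empty
    prefixes.\<close>
  define f where "f i = (if j < i then i - j else n - j + i)" for i
  have "f ` F y \<subseteq> {i \<in> {1..length ys}. list_prod (take i ys) \<in> H}"
  proof
    fix t assume "t \<in> f ` F y"
    then obtain i where i: "i \<in> F y" "t = f i" by auto
    have i1: "1 \<le> i" "i \<le> n" using i by (auto simp: F_def)
    have "list_prod (take t ys) = inv (P j) \<otimes> P i"
    proof (cases "j < i")
      case True
      have "take i xs = take j xs @ take (i - j) (drop j xs)"
        using True by (metis take_add le_add_diff_inverse less_imp_le)
      moreover have "set (take (i - j) (drop j xs)) \<subseteq> carrier G"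
        using cl(1) by (meson set_take_subset subset_trans)
      ultimately have "P i = P j \<otimes> list_prod (take (i - j) (drop j xs))"
        using cl(2) by (simp add: P_def)
      moreover have "take t ys = take (i - j) (drop j xs)"
        using True i i1 by (simp add: f_def ys_def n_def)
      ultimately show ?thesis
        using \<open>set (take (i - j) (drop j xs)) \<subseteq> carrier G\<close> by (simp flip: m_assoc)
    next
      case False
      then have "take t ys = drop j xs @ take i xs"
        using i jn by (simp add: f_def ys_def n_def min_def)
      then show ?thesis using cl by (simp add: dropP P_def)
    qed
    then show "t \<in> {i \<in> {1..length ys}. list_prod (take i ys) \<in> H}"
      using PH[OF i(1)] i i1 jn ys(4) by (auto simp: f_def)
  qed
  moreover have "inj_on f (F y)"
    using jn by (intro inj_onI) (auto simp: f_def F_def split: if_splits)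
  ultimately have "card (F y) \<le> card {i \<in> {1..length ys}. list_prod (take i ys) \<in> H}"
    by (intro card_inj_on_le) auto
  moreover obtain bs where bs: "concat bs = ys" "\<And>b. b \<in> set bs \<Longrightarrow> b \<noteq> [] \<and> list_prod b \<in> H"
    "length bs = card {i \<in> {1..length ys}. list_prod (take i ys) \<in> H}"
    using exists_block_decomposition[OF H ys(1)] ys(2) subgroup.one_closed[OF H] by auto
  ultimately have len: "length bs > k" using y by simp
  have bcl: "\<forall>b\<in>set bs. set b \<subseteq> carrier G" using ys(1) unfolding bs(1)[symmetric] set_concat by blast
  define M where "M = image_mset list_prod (mset bs)"
  have "M = mset (map list_prod bs)" by (simp add: M_def)
  moreover have "list_prod (map list_prod bs) = \<one>"
    using list_prod_concat[OF bcl] bs(1) ys(2) by simp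
  moreover have MH: "set_mset M \<subseteq> H" using bs(2) by (auto simp: M_def)
  ultimately have "product_one G M"
    unfolding product_one_iff using subgroup.subset[OF H] by blast
  moreover have "\<not> minimal_product_one G M"
    using bound[OF _ MH] len by (auto simp: M_def)
  moreover have "M \<noteq> {#}" using len by (auto simp: M_def)
  ultimately obtain T U where TU: "M = T + U" "T \<noteq> {#}" "U \<noteq> {#}" "product_one G T" "product_one G U"
    unfolding minimal_product_one_def by blast
  then obtain B C where BC: "mset bs = B + C" "T = image_mset list_prod B" "U = image_mset list_prod C"
    unfolding M_def by (meson image_mset_eq_plusD)
  have "S = (\<Sum>b\<in>#mset bs. mset b)"
    using ys(3) bs(1) by (metis mset_concat mset_map sum_mset_sum_list)
  then have SBC: "S = (\<Sum>b\<in>#B. mset b) + (\<Sum>b\<in>#C. mset b)" by (simp add: BC(1))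
  have "set bs = set_mset B \<union> set_mset C" using BC(1) by (metis set_mset_mset set_mset_union)
  then have sub: "set_mset B \<subseteq> {b. set b \<subseteq> carrier G \<and> b \<noteq> []}"
    "set_mset C \<subseteq> {b. set b \<subseteq> carrier G \<and> b \<noteq> []}"
    using bcl bs(2) by auto
  have "B \<noteq> {#}" "C \<noteq> {#}" using TU BC by auto
  then show False
    using S SBC product_one_concat[OF sub(1)] product_one_concat[OF sub(2)] TU(4,5)
    unfolding minimal_product_one_def BC(2,3) by blast
qed

end

section \<open>Divisibility and counting\<close>

lemma dvd_if_dvd_diff: "(d :: int) dvd x - y \<Longrightarrow> d dvd y \<Longrightarrow> d dvd x"
  using dvd_add[of d "x - y" y] by simp

lemma sum_mset_dvd: "(\<And>b. b \<in># A \<Longrightarrow> d dvd f b) \<Longrightarrow> d dvd (\<Sum>b\<in>#A. f b)"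
  for d :: "'a :: comm_semiring_1"
  by (induction A) auto

text \<open>Each term of \<open>N\<close> is counted at least once on the right. This is the
  pigeonhole principle that later finds a line with many terms.\<close>

lemma size_le_sum_size_filter:
  assumes "finite R" "\<And>x. x \<in># N \<Longrightarrow> \<exists>r\<in>R. Q r x"
  shows "size N \<le> (\<Sum>r\<in>R. size {#x \<in># N. Q r x#})"
  using assms(2)
proof (induction N)
  case (add x N)
  obtain r where r: "r \<in> R" "Q r x" using add.prems by auto
  have "(1::nat) \<le> (\<Sum>r\<in>R. if Q r x then 1 else 0)"
    using r assms(1) member_le_sum[of r R "\<lambda>r. if Q r x then 1 else 0 :: nat"] by simp
  moreover have "size N \<le> (\<Sum>r\<in>R. size {#x \<in># N. Q r x#})" using add by simp
  moreover have "(\<Sum>r\<in>R. size {#y \<in># add_mset x N. Q r y#}) =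
      (\<Sum>r\<in>R. if Q r x then 1 else 0) + (\<Sum>r\<in>R. size {#y \<in># N. Q r y#})"
    unfolding sum.distrib[symmetric] by (intro sum.cong) auto
  ultimately show ?case by simp
qed simp

section \<open>Groups with a commutator pairing\<close>

text \<open>Moving a term past others costs elements of \<open>K\<close>, which commute with all of
  \<open>A\<close> and can be collected at the right end. General \<open>K\<close> and
  \<open>A\<close> cover both \<open>K = C\<close>, \<open>A = H\<close> and the commuting case
  \<open>K = {\<one>}\<close>.\<close>

lemma (in group) list_prod_permute:
  assumes K: "subgroup K G" and A: "A \<subseteq> carrier G"
    and central: "\<And>k g. k \<in> K \<Longrightarrow> g \<in> A \<Longrightarrow> k \<otimes> g = g \<otimes> k"
    and comm: "\<And>g h. g \<in> A \<Longrightarrow> h \<in> A \<Longrightarrow> \<exists>k\<in>K. g \<otimes> h = h \<otimes> g \<otimes> k"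
    and xs: "set xs \<subseteq> A" "mset xs = mset ys"
  shows "\<exists>k\<in>K. list_prod xs = list_prod ys \<otimes> k"
proof -
  note KG = subgroup.mem_carrier[OF K] and K1 = subgroup.one_closed[OF K]
    and Km = subgroup.m_closed[OF K]
  have lp: "list_prod us \<in> carrier G" if "set us \<subseteq> A" for us
    using that A by (meson list_prod_closed subset_trans)
  have central': "k \<otimes> list_prod us = list_prod us \<otimes> k" if "k \<in> K" "set us \<subseteq> A" for k us
    using that(2)
  proof (induction us)
    case Nil
    then show ?case using KG[OF that(1)] by simp
  next
    case (Cons u us)
    have "k \<otimes> list_prod (u # us) = (k \<otimes> u) \<otimes> list_prod us"
      using KG[OF that(1)] lp Cons.prems A by (simp add: m_assoc subset_iff)
    also have "\<dots> = u \<otimes> (k \<otimes> list_prod us)"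
      using central[OF that(1)] KG[OF that(1)] lp Cons.prems A by (simp add: m_assoc subset_iff)
    also have "\<dots> = list_prod (u # us) \<otimes> k"
      using Cons KG[OF that(1)] lp A by (simp add: m_assoc subset_iff)
    finally show ?case .
  qed
  have move: "\<exists>k\<in>K. x \<otimes> list_prod us = list_prod us \<otimes> x \<otimes> k" if xA: "x \<in> A" and "set us \<subseteq> A" for x us
    using that(2)
  proof (induction us)
    case Nil
    then show ?case using K1 xA A by (intro bexI[of _ \<one>]) auto
  next
    case (Cons u us)
    then obtain k where k: "k \<in> K" "x \<otimes> list_prod us = list_prod us \<otimes> x \<otimes> k" by auto
    obtain l where l: "l \<in> K" "x \<otimes> u = u \<otimes> x \<otimes> l"
      using comm[of x u] xA Cons.prems by auto
    have cl: "x \<in> carrier G" "u \<in> carrier G" "k \<in> carrier G" "l \<in> carrier G"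
        "list_prod us \<in> carrier G"
      using xA A Cons.prems KG k l lp by auto
    have "x \<otimes> list_prod (u # us) = (x \<otimes> u) \<otimes> list_prod us" using cl by (simp add: m_assoc)
    also have "\<dots> = u \<otimes> (x \<otimes> (l \<otimes> list_prod us))" using cl by (simp add: l(2) m_assoc)
    also have "\<dots> = u \<otimes> ((x \<otimes> list_prod us) \<otimes> l)"
      using cl central'[OF l(1)] Cons.prems by (simp add: m_assoc)
    also have "\<dots> = list_prod (u # us) \<otimes> x \<otimes> (k \<otimes> l)" using cl by (simp add: k(2) m_assoc)
    finally show ?case using Km k(1) l(1) by blast
  qed
  show ?thesis using xs
  proof (induction xs arbitrary: ys)
    case Nil
    then show ?case using K1 by (intro bexI[of _ \<one>]) auto
  next
    case (Cons x xs)
    then have "x \<in> set ys" by (metis list.set_intros(1) set_mset_mset)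
    then obtain us vs where ys: "ys = us @ x # vs" by (meson split_list)
    have "set ys = set (x # xs)" using Cons.prems(2) by (metis set_mset_mset)
    then have sub: "x \<in> A" "set us \<subseteq> A" "set vs \<subseteq> A" "set xs \<subseteq> A"
      using Cons.prems(1) ys by auto
    have "mset xs = mset (us @ vs)" using Cons.prems(2) ys by simp
    then obtain k where k: "k \<in> K" "list_prod xs = list_prod (us @ vs) \<otimes> k"
      using Cons.IH sub by blast
    obtain l where l: "l \<in> K" "x \<otimes> list_prod us = list_prod us \<otimes> x \<otimes> l"
      using move sub by blast
    have sG: "set us \<subseteq> carrier G" "set vs \<subseteq> carrier G" "x \<in> carrier G" using sub A by auto
    have cl: "list_prod us \<in> carrier G" "list_prod vs \<in> carrier G" "k \<in> carrier G" "l \<in> carrier G"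
      using sub lp KG k l by auto
    have "list_prod (x # xs) = (x \<otimes> list_prod us) \<otimes> (list_prod vs \<otimes> k)"
      using cl sG by (simp add: k(2) m_assoc)
    also have "\<dots> = list_prod us \<otimes> x \<otimes> (l \<otimes> list_prod vs) \<otimes> k"
      using cl sG by (simp add: l(2) m_assoc)
    also have "\<dots> = list_prod ys \<otimes> (l \<otimes> k)"
      using cl sG central'[OF l(1) sub(3)] by (simp add: ys m_assoc)
    finally show ?case using Km k(1) l(1) by blast
  qed
qed

text \<open>The pair \<open>(\<alpha>, \<beta>)\<close> is a homomorphism from \<open>H\<close> to \<open>(\<int>/p)\<^sup>2\<close>, and commutators are given by the
  determinant form on \<open>(\<int>/p)\<^sup>2\<close>; its kernel \<open>Z\<close> is therefore central in \<open>H\<close>.\<close>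

locale commutator_pairing = group G for G (structure) +
  fixes H :: "'a set" and c :: 'a and p :: nat and \<alpha> \<beta> :: "'a \<Rightarrow> int"
  assumes H: "subgroup H G" and finite_H: "finite H" and p: "Factorial_Ring.prime p"
    and c: "c \<in> H" "c \<noteq> \<one>" "c [^] p = \<one>"
    and c_comm: "g \<in> H \<Longrightarrow> c \<otimes> g = g \<otimes> c"
    and \<alpha>_mult: "g \<in> H \<Longrightarrow> h \<in> H \<Longrightarrow> int p dvd \<alpha> (g \<otimes> h) - (\<alpha> g + \<alpha> h)"
    and \<beta>_mult: "g \<in> H \<Longrightarrow> h \<in> H \<Longrightarrow> int p dvd \<beta> (g \<otimes> h) - (\<beta> g + \<beta> h)"
    and commute: "g \<in> H \<Longrightarrow> h \<in> H \<Longrightarrow> g \<otimes> h = h \<otimes> g \<otimes> c [^] (\<beta> g * \<alpha> h - \<alpha> g * \<beta> h)"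
begin

lemmas H_closed [simp] = subgroup.mem_carrier[OF H]
  and one_in_H [simp] = subgroup.one_closed[OF H]
  and mult_in_H [simp] = subgroup.m_closed[OF H]

lemma H_sub: "H \<subseteq> carrier G" using H by (rule subgroup.subset)

lemma p_gt_1: "p > 1" using p by (rule prime_gt_1_nat)

lemma c_closed [simp]: "c \<in> carrier G" using c(1) by simp

lemma ord_c: "ord c = p"
  using c pow_eq_id[of c p] p pow_eq_id[of c 1] by (auto simp: prime_nat_iff)

lemma c_pow_eq_one: "c [^] (i :: int) = \<one> \<longleftrightarrow> int p dvd i"
  by (simp add: int_pow_eq_id ord_c)

lemma c_pow_cong: "int p dvd i - j \<Longrightarrow> c [^] (i :: int) = c [^] j"
  using int_pow_eq[of c i j] by (simp add: ord_c dvd_diff_commute)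

lemma c_pow_in_H [simp]: "c [^] (i :: int) \<in> H"
  using c(1) H by (simp add: subgroup_int_pow_closed)

lemma commute_iff:
  assumes "g \<in> H" "h \<in> H"
  shows "g \<otimes> h = h \<otimes> g \<longleftrightarrow> int p dvd \<beta> g * \<alpha> h - \<alpha> g * \<beta> h"
proof -
  have "g \<otimes> h = h \<otimes> g \<longleftrightarrow> h \<otimes> g \<otimes> c [^] (\<beta> g * \<alpha> h - \<alpha> g * \<beta> h) = h \<otimes> g"
    using commute[OF assms] by simp
  also have "\<dots> \<longleftrightarrow> c [^] (\<beta> g * \<alpha> h - \<alpha> g * \<beta> h) = \<one>"
    using assms by simp
  finally show ?thesis by (simp add: c_pow_eq_one)
qed

section \<open>The subgroup generated by \<open>c\<close>\<close>

definition C where "C = range (\<lambda>i::int. c [^] i)"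

lemma C_subgroup: "subgroup C G"
proof (rule subgroupI)
  show "C \<subseteq> carrier G" "C \<noteq> {}" by (auto simp: C_def)
  show "inv a \<in> C" if "a \<in> C" for a
    using that by (auto simp: C_def simp flip: int_pow_neg)
  show "a \<otimes> b \<in> C" if "a \<in> C" "b \<in> C" for a b
    using that by (auto simp: C_def simp flip: int_pow_mult)
qed

lemma C_central: "k \<in> C \<Longrightarrow> g \<in> H \<Longrightarrow> k \<otimes> g = g \<otimes> k"
proof -
  assume k: "k \<in> C" and g: "g \<in> H"
  have n: "c [^] (n::nat) \<otimes> g = g \<otimes> c [^] n" for n
  proof (induction n)
    case (Suc n)
    have "c [^] Suc n \<otimes> g = c [^] n \<otimes> (c \<otimes> g)" using g by (simp add: m_assoc)
    also have "\<dots> = (c [^] n \<otimes> g) \<otimes> c" using g by (simp add: c_comm m_assoc)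
    also have "\<dots> = g \<otimes> c [^] Suc n" using g by (simp add: Suc m_assoc)
    finally show ?case .
  qed (use g in simp)
  obtain i where i: "k = c [^] (i :: int)" using k by (auto simp: C_def)
  have "c [^] i = c [^] (i mod int p)"
    by (intro c_pow_cong) (simp add: minus_mod_eq_mult_div)
  also have "\<dots> = c [^] nat (i mod int p)"
    using p_gt_1 by (simp flip: int_pow_int)
  finally show ?thesis using n i by simp
qed

lemma card_C: "finite C" "card C \<le> p"
proof -
  have "C \<subseteq> (\<lambda>i. c [^] i) ` {0..<int p}"
  proof
    fix k assume "k \<in> C"
    then obtain i where "k = c [^] (i :: int)" by (auto simp: C_def)
    then have "k = c [^] (i mod int p)"
      using c_pow_cong[of i "i mod int p"] by (simp add: minus_mod_eq_mult_div)
    then show "k \<in> (\<lambda>i. c [^] i) ` {0..<int p}" using p_gt_1 by auto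
  qed
  then show "finite C" "card C \<le> p"
    using finite_surj[of "{0..<int p}"] surj_card_le[of "{0..<int p}"] by auto
qed

lemma list_prod_permute_H:
  assumes "set xs \<subseteq> H" "mset xs = mset ys"
  shows "\<exists>k\<in>C. list_prod xs = list_prod ys \<otimes> k"
  by (rule list_prod_permute[OF C_subgroup H_sub C_central _ assms]) (auto simp: C_def intro!: commute)

section \<open>The kernel of the two coordinates\<close>

definition Z where "Z = {g \<in> H. int p dvd \<alpha> g \<and> int p dvd \<beta> g}"

lemma Z_sub: "Z \<subseteq> H" by (auto simp: Z_def)

lemma finite_Z: "finite Z" using Z_sub finite_H by (rule finite_subset)

lemma \<alpha>_one: "int p dvd \<alpha> \<one>" and \<beta>_one: "int p dvd \<beta> \<one>"
  using \<alpha>_mult[of \<one> \<one>] \<beta>_mult[of \<one> \<one>] by simp_all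

lemma Z_subgroup: "subgroup Z G"
proof (rule subgroupI)
  show "Z \<subseteq> carrier G" using Z_sub H_sub by blast
  show "Z \<noteq> {}" using \<alpha>_one \<beta>_one by (auto simp: Z_def)
next
  fix a assume a: "a \<in> Z"
  then have aH: "a \<in> H" "inv a \<in> H" using H by (auto simp: Z_def subgroup.m_inv_closed)
  have "int p dvd \<alpha> \<one> - (\<alpha> a + \<alpha> (inv a))" "int p dvd \<beta> \<one> - (\<beta> a + \<beta> (inv a))"
    using \<alpha>_mult[of a "inv a"] \<beta>_mult[of a "inv a"] aH by simp_all
  then show "inv a \<in> Z"
    using aH a \<alpha>_one \<beta>_one unfolding Z_def
    by (auto simp: dvd_diff_right_iff dvd_add_right_iff)
next
  fix a b assume ab: "a \<in> Z" "b \<in> Z"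
  then have "int p dvd \<alpha> (a \<otimes> b) - (\<alpha> a + \<alpha> b)" "int p dvd \<beta> (a \<otimes> b) - (\<beta> a + \<beta> b)"
    using \<alpha>_mult \<beta>_mult by (auto simp: Z_def)
  then show "a \<otimes> b \<in> Z"
    using ab unfolding Z_def by (auto intro: dvd_if_dvd_diff dvd_add)
qed

lemma Z_central: "z \<in> Z \<Longrightarrow> g \<in> H \<Longrightarrow> z \<otimes> g = g \<otimes> z"
  by (subst commute_iff) (auto simp: Z_def)

lemma \<alpha>_list_prod:
  assumes "set xs \<subseteq> H"
  shows "int p dvd \<alpha> (list_prod xs) - (\<Sum>x\<in>#mset xs. \<alpha> x)"
    and "int p dvd \<beta> (list_prod xs) - (\<Sum>x\<in>#mset xs. \<beta> x)"
proof -
  have "int p dvd \<alpha> (list_prod xs) - (\<Sum>x\<in>#mset xs. \<alpha> x) \<and>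
      int p dvd \<beta> (list_prod xs) - (\<Sum>x\<in>#mset xs. \<beta> x)"
    using assms
  proof (induction xs)
    case (Cons x xs)
    then have "list_prod xs \<in> H" "x \<in> H" using list_prod_in_subgroup[OF H] by auto
    then have "int p dvd (\<alpha> (list_prod (x # xs)) - (\<alpha> x + \<alpha> (list_prod xs)))
          + (\<alpha> (list_prod xs) - (\<Sum>x\<in>#mset xs. \<alpha> x))"
      "int p dvd (\<beta> (list_prod (x # xs)) - (\<beta> x + \<beta> (list_prod xs)))
          + (\<beta> (list_prod xs) - (\<Sum>x\<in>#mset xs. \<beta> x))"
      using Cons \<alpha>_mult[of x "list_prod xs"] \<beta>_mult[of x "list_prod xs"]
      by (simp_all only: dvd_add list_prod_simps set_simps insert_subset)
    then show ?case by (simp add: algebra_simps)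
  qed (simp add: \<alpha>_one \<beta>_one)
  then show "int p dvd \<alpha> (list_prod xs) - (\<Sum>x\<in>#mset xs. \<alpha> x)"
    and "int p dvd \<beta> (list_prod xs) - (\<Sum>x\<in>#mset xs. \<beta> x)" by auto
qed

lemma list_prod_in_Z:
  assumes "set xs \<subseteq> H" "int p dvd (\<Sum>x\<in>#mset xs. \<alpha> x)" "int p dvd (\<Sum>x\<in>#mset xs. \<beta> x)"
  shows "list_prod xs \<in> Z"
  using \<alpha>_list_prod[OF assms(1)] assms list_prod_in_subgroup[OF H assms(1)]
  unfolding Z_def by (auto intro: dvd_if_dvd_diff)

section \<open>Product-one subsequences of long sequences\<close>

text \<open>While at least \<open>3 * p - 2\<close> terms remain, a block of at most
  \<open>p\<close> terms with product in \<open>Z\<close> can be removed. For the last block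
  \<open>2 * p - 1\<close> terms suffice, as its length does not matter.\<close>

lemma exists_Z_blocks:
  assumes "size M \<ge> Suc q * p + p - 1" "set_mset M \<subseteq> H"
  shows "\<exists>ts. length ts = Suc q \<and> mset (concat ts) \<subseteq># M \<and>
    (\<forall>t\<in>set ts. t \<noteq> [] \<and> set t \<subseteq> H \<and> list_prod t \<in> Z)"
  using assms
proof (induction q arbitrary: M)
  case 0
  have "length [\<alpha>, \<beta>] * (p - 1) < size M" using 0 p_gt_1 by simp
  then obtain T where T: "T \<subseteq># M" "T \<noteq> {#}"
    and z: "\<And>f. f \<in> set [\<alpha>, \<beta>] \<Longrightarrow> int p dvd (\<Sum>x\<in>#T. f x)"
    by (rule exists_zero_sum[OF p]) blast
  obtain t where t: "mset t = T" using ex_mset by blast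
  then have "set t \<subseteq> H" using T(1) 0(2) by (metis set_mset_mono set_mset_mset subset_trans)
  moreover have "list_prod t \<in> Z"
    using list_prod_in_Z[OF calculation] z[of \<alpha>] z[of \<beta>] t by simp
  ultimately show ?case using t T by (intro exI[of _ "[t]"]) auto
next
  case (Suc q)
  have "size M \<ge> 3 * p - 2" using Suc.prems(1) by simp
  then obtain T where T: "T \<subseteq># M" "T \<noteq> {#}" "size T \<le> p"
    and z: "int p dvd (\<Sum>x\<in>#T. \<alpha> x)" "int p dvd (\<Sum>x\<in>#T. \<beta> x)"
    by (rule exists_short_zero_sum[OF p, of M \<alpha> \<beta>]) blast
  obtain t where t: "mset t = T" using ex_mset by blast
  then have tH: "set t \<subseteq> H" using T(1) Suc.prems(2) by (metis set_mset_mono set_mset_mset subset_trans)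
  have tZ: "list_prod t \<in> Z" using list_prod_in_Z[OF tH] z t by simp
  have "set_mset (M - T) \<subseteq> H" using Suc.prems(2) by (meson in_diffD subset_iff)
  moreover have "size (M - T) \<ge> Suc q * p + p - 1"
    using Suc.prems(1) T by (simp add: size_Diff_submset)
  ultimately obtain ts where ts: "length ts = Suc q" "mset (concat ts) \<subseteq># M - T"
    "\<forall>t\<in>set ts. t \<noteq> [] \<and> set t \<subseteq> H \<and> list_prod t \<in> Z"
    using Suc.IH by blast
  have "mset (concat (t # ts)) \<subseteq># M"
    using ts(2) T(1) t by (simp add: subset_mset.le_diff_conv2 add.commute)
  then show ?case using ts t T(2) tH tZ by (intro exI[of _ "t # ts"]) auto
qed

text \<open>The products of \<open>card Z\<close> blocks contain a consecutive run with product one,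
  and the blocks of that run concatenate to an ordering of \<open>W\<close>.\<close>

lemma exists_product_one:
  assumes "size M \<ge> card Z * p + p - 1" "set_mset M \<subseteq> H"
  obtains W where "W \<subseteq># M" "W \<noteq> {#}" "product_one G W"
proof -
  have "card Z > 0" using finite_Z subgroup.one_closed[OF Z_subgroup] by (auto simp: card_gt_0_iff)
  then obtain q where q: "card Z = Suc q" using gr0_conv_Suc by blast
  obtain ts where ts: "length ts = card Z" "mset (concat ts) \<subseteq># M"
    "\<forall>t\<in>set ts. t \<noteq> [] \<and> set t \<subseteq> H \<and> list_prod t \<in> Z"
    using exists_Z_blocks[of q M] assms q by auto
  have "set (map list_prod ts) \<subseteq> Z" "length (map list_prod ts) \<ge> card Z" using ts by auto
  then obtain us bs vs where "map list_prod ts = us @ bs @ vs" "bs \<noteq> []" "list_prod bs = \<one>"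
    by (rule exists_consecutive_product_one[OF Z_subgroup finite_Z])
  then obtain us' bs' vs' where b: "ts = us' @ bs' @ vs'" "map list_prod bs' = bs"
    by (metis map_eq_append_conv)
  have cl: "\<forall>b\<in>set bs'. set b \<subseteq> carrier G" using ts(3) b(1) H_sub by auto
  have "list_prod (concat bs') = \<one>"
    using list_prod_concat[OF cl] b(2) \<open>list_prod bs = \<one>\<close> by simp
  moreover have "set (concat bs') \<subseteq> carrier G" using cl by auto
  ultimately have "product_one G (mset (concat bs'))"
    unfolding product_one_iff by (metis set_mset_mset)
  moreover have "mset (concat bs') \<subseteq># M"
    using ts(2) b(1) by (simp add: subset_mset.add_decreasing mset_subset_eq_exists_conv) (metis add.left_commute union_assoc)
  moreover have "mset (concat bs') \<noteq> {#}"
    using \<open>bs \<noteq> []\<close> b ts(3) by (cases bs') auto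
  ultimately show ?thesis using that by blast
qed

section \<open>Products of all orderings of a sequence\<close>

definition prods where "prods M = {list_prod xs | xs. mset xs = M}"

lemma prods_sub: "set_mset M \<subseteq> H \<Longrightarrow> prods M \<subseteq> H"
  by (auto simp: prods_def intro!: list_prod_in_subgroup[OF H])

lemma finite_prods: "set_mset M \<subseteq> H \<Longrightarrow> finite (prods M)"
  using prods_sub finite_H by (metis finite_subset)

lemma prods_nonempty: "prods M \<noteq> {}"
  using ex_mset[of M] by (auto simp: prods_def)

text \<open>If \<open>P\<close> is the set of products of a sequence, then \<open>a P\<close> is \<open>P a\<close> shifted by a non-trivial power of
  \<open>c\<close>; hence adding \<open>a\<close> produces a new product unless \<open>P a\<close> is already a full coset of \<open>\<langle>c\<rangle>\<close>.\<close>

lemma card_prods_ge: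
  assumes "set_mset A \<subseteq> H" "h \<in> H"
    and "\<And>a b. a \<in># A \<Longrightarrow> b \<in># A \<Longrightarrow> a \<otimes> b = b \<otimes> a"
    and "\<And>a. a \<in># A \<Longrightarrow> a \<otimes> h \<noteq> h \<otimes> a"
  shows "card (prods (add_mset h A)) \<ge> min p (size A + 1)"
  using assms
proof (induction A)
  case empty
  then show ?case
    using finite_prods[of "{#h#}"] prods_nonempty[of "{#h#}"] by (simp add: Suc_le_eq card_gt_0_iff min.coboundedI2)
next
  case (add a A)
  define P where "P = prods (add_mset h A)"
  define Q where "Q = prods (add_mset h (add_mset a A))"
  have aH: "a \<in> H" "a \<in> carrier G" and AH: "set_mset A \<subseteq> H" using add.prems H_sub by auto
  have IH: "card P \<ge> min p (size A + 1)"
    unfolding P_def by (rule add.IH) (use add.prems in auto)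
  have PH: "P \<subseteq> H" "finite P" "P \<noteq> {}"
    using AH add.prems(2) prods_sub finite_prods prods_nonempty by (auto simp: P_def)
  have QH: "Q \<subseteq> H" "finite Q"
    using AH aH add.prems(2) prods_sub finite_prods by (auto simp: Q_def)
  define L R where "L = (\<lambda>g. a \<otimes> g) ` P" and "R = (\<lambda>g. g \<otimes> a) ` P"
  have "L \<subseteq> Q"
  proof
    fix y assume "y \<in> L"
    then obtain xs where "mset xs = add_mset h A" "y = a \<otimes> list_prod xs"
      by (auto simp: L_def P_def prods_def)
    then show "y \<in> Q" unfolding Q_def prods_def
      by (intro CollectI exI[of _ "a # xs"]) (simp add: add_mset_commute)
  qed
  have "R \<subseteq> Q"
  proof
    fix y assume "y \<in> R"
    then obtain xs where xs: "mset xs = add_mset h A" "y = list_prod xs \<otimes> a"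
      by (auto simp: R_def P_def prods_def)
    then have "set xs \<subseteq> carrier G"
      using AH add.prems(2) H_sub by (metis insert_subset set_mset_add_mset_insert set_mset_mset subset_trans)
    then show "y \<in> Q" unfolding Q_def prods_def
      using xs aH by (intro CollectI exI[of _ "xs @ [a]"]) (simp add: add_mset_commute)
  qed
  have cards: "card L = card P" "card R = card P"
    unfolding L_def R_def using PH(1) aH H_sub
    by (auto intro!: card_image inj_onI simp: subset_iff)
  have "card Q \<ge> min p (size A + 2)"
  proof (cases "L \<subseteq> R")
    case False
    \<comment> \<open>\<open>L\<close> and \<open>R\<close> have equal size, so the union gains at
      least one element over \<open>R\<close>.\<close>
    then have "card R < card (L \<union> R)"
      using QH \<open>L \<subseteq> Q\<close> \<open>R \<subseteq> Q\<close> by (intro psubset_card_mono) (auto intro: finite_subset)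
    also have "\<dots> \<le> card Q" using QH \<open>L \<subseteq> Q\<close> \<open>R \<subseteq> Q\<close> by (intro card_mono) auto
    finally show ?thesis using IH cards by simp
  next
    case True
    define t where "t = \<beta> a * \<alpha> h - \<alpha> a * \<beta> h"
    have t: "\<not> int p dvd t"
      using add.prems(4)[of a] commute_iff[OF aH(1) add.prems(2)] by (simp add: t_def)
    \<comment> \<open>As \<open>a\<close> commutes with every term of \<open>A\<close>, its
      commutator with a product over \<open>add_mset h A\<close> depends on \<open>h\<close>
      alone.\<close>
    have twist: "a \<otimes> g = g \<otimes> a \<otimes> c [^] t" if gP: "g \<in> P" for g
    proof -
      obtain xs where xs: "mset xs = add_mset h A" "g = list_prod xs"
        using gP by (auto simp: P_def prods_def)
      have xsH: "set xs \<subseteq> H"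
        using xs(1) AH add.prems(2) by (metis insert_subset set_mset_add_mset_insert set_mset_mset)
      have "int p dvd (\<Sum>b\<in>#A. \<beta> a * \<alpha> b - \<alpha> a * \<beta> b)"
      proof (rule sum_mset_dvd)
        fix b assume b: "b \<in># A"
        then have "a \<otimes> b = b \<otimes> a" "b \<in> H" using add.prems(3)[of a b] AH by auto
        then show "int p dvd \<beta> a * \<alpha> b - \<alpha> a * \<beta> b" using commute_iff[OF aH(1)] by blast
      qed
      moreover have "int p dvd \<beta> a * (\<alpha> g - (\<Sum>x\<in>#add_mset h A. \<alpha> x))
          - \<alpha> a * (\<beta> g - (\<Sum>x\<in>#add_mset h A. \<beta> x))"
        using \<alpha>_list_prod[OF xsH] by (simp add: xs)
      ultimately have "int p dvd (\<beta> a * (\<alpha> g - (\<Sum>x\<in>#add_mset h A. \<alpha> x))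
          - \<alpha> a * (\<beta> g - (\<Sum>x\<in>#add_mset h A. \<beta> x))) + (\<Sum>b\<in>#A. \<beta> a * \<alpha> b - \<alpha> a * \<beta> b)"
        by (rule dvd_add[rotated])
      also have "(\<Sum>b\<in>#A. \<beta> a * \<alpha> b - \<alpha> a * \<beta> b) = \<beta> a * (\<Sum>b\<in>#A. \<alpha> b) - \<alpha> a * (\<Sum>b\<in>#A. \<beta> b)"
        by (induction A) (simp_all add: algebra_simps)
      finally have "int p dvd (\<beta> a * \<alpha> g - \<alpha> a * \<beta> g) - t"
        by (simp add: t_def algebra_simps)
      then show ?thesis
        using commute[of a g] aH gP PH(1) c_pow_cong by auto
    qed
    obtain g where g: "g \<in> P" using PH(3) by blast
    have gG: "g \<in> carrier G" using g PH(1) H_sub by auto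
    \<comment> \<open>Since \<open>L\<close> lies inside \<open>R\<close>, multiplying an element of
      \<open>R\<close> by \<open>c [^] t\<close> gives an element of \<open>R\<close> again; as
      \<open>c [^] t\<close> has order \<open>p\<close>, this forces \<open>R\<close> to have at
      least \<open>p\<close> elements.\<close>
    have orbit: "g \<otimes> a \<otimes> (c [^] t) [^] (n::nat) \<in> R" for n
    proof (induction n)
      case 0
      then show ?case using g gG aH by (auto simp: R_def)
    next
      case (Suc n)
      then obtain g' where g': "g' \<in> P" "g \<otimes> a \<otimes> (c [^] t) [^] n = g' \<otimes> a" by (auto simp: R_def)
      have "g \<otimes> a \<otimes> (c [^] t) [^] Suc n = a \<otimes> g'"
        using g' twist[OF g'(1)] gG aH by (simp add: m_assoc flip: g'(2))
      then show ?case using True g'(1) by (auto simp: L_def)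
    qed
    have "inj_on (\<lambda>n. g \<otimes> a \<otimes> (c [^] t) [^] n) {..<p}"
    proof (rule inj_onI)
      fix m n assume mn: "m \<in> {..<p}" "n \<in> {..<p}"
        "g \<otimes> a \<otimes> (c [^] t) [^] m = g \<otimes> a \<otimes> (c [^] t) [^] n"
      then have "(c [^] t) [^] m = (c [^] t) [^] n" using gG aH by simp
      then have "c [^] (t * int m) = c [^] (t * int n)"
        by (simp add: int_pow_pow flip: int_pow_int)
      then have "int p dvd t * (int n - int m)"
        using int_pow_eq[of c "t * int m" "t * int n"] by (simp add: ord_c algebra_simps dvd_diff_commute)
      then have "int p dvd int n - int m"
        using t p by (metis prime_dvd_mult_iff prime_int_nat_transfer prime_nat_int_transfer)
      then show "m = n" using mn(1,2)
        by (metis lessThan_iff mod_eq_dvd_iff mod_less of_nat_eq_iff zmod_int)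
    qed
    then have "p \<le> card R"
      using card_inj_on_le[of "\<lambda>n. g \<otimes> a \<otimes> (c [^] t) [^] n" "{..<p}" R] orbit PH(2)
      by (auto simp: R_def)
    also have "\<dots> \<le> card Q" using QH \<open>R \<subseteq> Q\<close> by (intro card_mono) auto
    finally show ?thesis by simp
  qed
  then show ?case by (simp add: Q_def)
qed

text \<open>All products lie in the coset \<open>g C\<close>, which has at most \<open>p\<close>
  elements, and \<open>card_prods_ge\<close> provides at least \<open>p\<close> of them; so they
  fill the coset.\<close>

lemma prods_full:
  assumes "set_mset A \<subseteq> H" "h \<in> H" "size A = p - 1"
    and "\<And>a b. a \<in># A \<Longrightarrow> b \<in># A \<Longrightarrow> a \<otimes> b = b \<otimes> a"
    and "\<And>a. a \<in># A \<Longrightarrow> a \<otimes> h \<noteq> h \<otimes> a"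
    and g: "g \<in> prods (add_mset h A)" and k: "k \<in> C"
  shows "g \<otimes> k \<in> prods (add_mset h A)"
proof -
  obtain xs where xs: "mset xs = add_mset h A" "g = list_prod xs"
    using g by (auto simp: prods_def)
  have "prods (add_mset h A) \<subseteq> (\<lambda>k. g \<otimes> k) ` C"
  proof
    fix y assume "y \<in> prods (add_mset h A)"
    then obtain ys where ys: "mset ys = add_mset h A" "y = list_prod ys"
      by (auto simp: prods_def)
    have "set ys \<subseteq> H"
      using ys(1) assms(1,2) by (metis insert_subset set_mset_add_mset_insert set_mset_mset)
    then show "y \<in> (\<lambda>k. g \<otimes> k) ` C"
      using list_prod_permute_H[of ys xs] xs ys by auto
  qed
  moreover have "card ((\<lambda>k. g \<otimes> k) ` C) \<le> card (prods (add_mset h A))"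
    using card_image_le[OF card_C(1), of "\<lambda>k. g \<otimes> k"] card_C(2)
      card_prods_ge[of A h, OF assms(1,2,4,5)] assms(3) p_gt_1 by simp
  ultimately have "prods (add_mset h A) = (\<lambda>k. g \<otimes> k) ` C"
    using card_C(1) by (intro card_seteq) auto
  then show ?thesis using k by blast
qed

section \<open>Terms in the kernel\<close>

text \<open>Elements of \<open>Z\<close> commute with \<open>H\<close>, so they can be pulled to the
  front one by one and in the order of \<open>bs\<close>.\<close>

lemma extract_kernel_terms:
  assumes "set xs \<subseteq> H" "mset bs \<subseteq># mset xs" "set bs \<subseteq> Z"
  shows "\<exists>rs. mset xs = mset bs + mset rs \<and> list_prod xs = list_prod bs \<otimes> list_prod rs"
  using assms
proof (induction bs arbitrary: xs)
  case Nil
  then show ?case using H_sub by (intro exI[of _ xs]) (simp add: subset_trans)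
next
  case (Cons z bs)
  then have "z \<in> set xs" by (metis insert_subset mset.simps(2) mset_subset_eq_insertD set_mset_mset)
  then obtain us vs where xs: "xs = us @ z # vs" by (meson split_list)
  have uvH: "set us \<subseteq> H" "set vs \<subseteq> H" "z \<in> H" "z \<in> Z" using Cons.prems xs by auto
  then have uv: "set us \<subseteq> carrier G" "set vs \<subseteq> carrier G" using H_sub by auto
  obtain rs where rs: "mset (us @ vs) = mset bs + mset rs"
    "list_prod (us @ vs) = list_prod bs \<otimes> list_prod rs"
    using Cons.IH[of "us @ vs"] Cons.prems uvH xs by auto
  have "mset rs \<subseteq># mset xs" using rs(1) xs by (simp add: subset_mset.add_increasing)
  then have "set rs \<subseteq> H" using Cons.prems(1) by (metis set_mset_mono set_mset_mset subset_trans)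
  then have "list_prod rs \<in> H" "list_prod bs \<in> H" "list_prod us \<in> H" "list_prod vs \<in> H"
    using Cons.prems(3) Z_sub uvH by (auto intro!: list_prod_in_subgroup[OF H])
  note cl = this[THEN H_closed] H_closed[OF uvH(3)]
  have "list_prod xs = (list_prod us \<otimes> z) \<otimes> list_prod vs"
    using uv uvH cl by (simp add: xs m_assoc)
  also have "\<dots> = (z \<otimes> list_prod us) \<otimes> list_prod vs"
    using Z_central[OF uvH(4) \<open>list_prod us \<in> H\<close>] by simp
  also have "\<dots> = z \<otimes> list_prod (us @ vs)" using uv cl by (simp add: m_assoc)
  also have "\<dots> = list_prod (z # bs) \<otimes> list_prod rs" using cl by (simp add: rs(2) m_assoc)
  finally show ?case using rs(1) xs by (intro exI[of _ rs]) simp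
qed

text \<open>Otherwise a product-one run among \<open>card Z\<close> of these terms could be pulled
  out of a product-one ordering of \<open>S\<close>, leaving a product-one rest.\<close>

lemma few_kernel_terms:
  assumes S: "minimal_product_one G S" "set_mset S \<subseteq> H" "size S > card Z"
  shows "size {#g \<in># S. g \<in> Z#} < card Z"
proof (rule ccontr)
  assume "\<not> ?thesis"
  moreover obtain zs where zs: "mset zs = {#g \<in># S. g \<in> Z#}" using ex_mset by blast
  ultimately have len: "length zs \<ge> card Z" by (metis not_less size_mset)
  have "set zs \<subseteq> Z" using arg_cong[OF zs, of set_mset] by auto
  \<comment> \<open>Only \<open>card Z\<close> terms are kept, so that \<open>bs\<close> is shorter
    than \<open>S\<close> and the rest is non-empty.\<close>
  then have tZ: "set (take (card Z) zs) \<subseteq> Z" by (meson set_take_subset subset_trans)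
  have "length (take (card Z) zs) \<ge> card Z" using len by simp
  then obtain us bs vs where z: "take (card Z) zs = us @ bs @ vs" "bs \<noteq> []" "list_prod bs = \<one>"
    by (rule exists_consecutive_product_one[OF Z_subgroup finite_Z tZ])
  have bsZ: "set bs \<subseteq> Z" using z(1) tZ by auto
  obtain xs where xs: "mset xs = S" "list_prod xs = \<one>"
    using S(1) by (auto simp: minimal_product_one_def product_one_iff)
  have xsH: "set xs \<subseteq> H" using S(2) xs(1) by auto
  have "mset zs = mset (take (card Z) zs) + mset (drop (card Z) zs)"
    by (metis append_take_drop_id mset_append)
  then have "mset bs \<subseteq># mset zs" unfolding z(1) by (simp add: subset_mset.add_increasing subset_mset.add_increasing2)
  then have "mset bs \<subseteq># mset xs" using zs xs by (metis multiset_filter_subset subset_mset.trans)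
  then obtain rs where rs: "mset xs = mset bs + mset rs" "list_prod xs = list_prod bs \<otimes> list_prod rs"
    using extract_kernel_terms[OF xsH _ bsZ] by blast
  have "length bs \<le> length (take (card Z) zs)" using z(1) by simp
  moreover have "size S = length bs + length rs" using xs(1) rs(1) by (metis size_mset size_union)
  ultimately have "rs \<noteq> []" using S(3) by auto
  have "set xs = set bs \<union> set rs" using rs(1) by (metis set_mset_mset set_mset_union)
  then have sub: "set bs \<subseteq> carrier G" "set rs \<subseteq> carrier G" using xsH H_sub by auto
  then have "list_prod rs = \<one>" using rs(2) xs(2) z(3) by simp
  then have "product_one G (mset bs)" "product_one G (mset rs)"
    using z(3) sub by (auto simp: product_one_iff)
  then show False
    using S(1) rs(1) xs(1) z(2) \<open>rs \<noteq> []\<close> unfolding minimal_product_one_def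
    by (metis mset_zero_iff)
qed

text \<open>A product-one subsequence \<open>W\<close> of \<open>S - T\<close> splits off from \<open>S\<close>: the product of the remaining terms
  lies in \<open>K\<close>, and reordering \<open>T\<close> corrects it to \<open>\<one>\<close>.\<close>

lemma size_rest_less:
  assumes S: "minimal_product_one G S" "set_mset S \<subseteq> H" and T: "T \<subseteq># S" "T \<noteq> {#}"
    and K: "K \<subseteq> C" and perm: "\<And>xs ys. mset xs = S \<Longrightarrow> mset ys = S \<Longrightarrow>
      \<exists>k\<in>K. list_prod xs = list_prod ys \<otimes> k"
    and full: "\<And>g k. g \<in> prods T \<Longrightarrow> k \<in> K \<Longrightarrow> g \<otimes> k \<in> prods T"
  shows "size (S - T) < card Z * p + p - 1"
proof (rule ccontr)
  assume "\<not> ?thesis"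
  moreover have "set_mset (S - T) \<subseteq> H" using S(2) by (meson in_diffD subset_iff)
  ultimately obtain W where W: "W \<subseteq># S - T" "W \<noteq> {#}" "product_one G W"
    using exists_product_one[of "S - T"] by (metis not_less)
  define R where "R = S - T - W"
  have S_eq: "S = W + (T + R)" using W(1) T(1)
    by (metis R_def add.left_commute subset_mset.add_diff_inverse)
  obtain ws where ws: "mset ws = W" "list_prod ws = \<one>" using W(3) by (auto simp: product_one_iff)
  obtain t where t: "mset t = T" using ex_mset by blast
  obtain rs where rs: "mset rs = R" using ex_mset by blast
  obtain xs where xs: "mset xs = S" "list_prod xs = \<one>"
    using S(1) by (auto simp: minimal_product_one_def product_one_iff)
  obtain k where k: "k \<in> K" "list_prod xs = list_prod (ws @ t @ rs) \<otimes> k"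
    using perm[of xs "ws @ t @ rs"] xs S_eq ws t rs by auto
  have kG: "k \<in> carrier G" using k(1) K subgroup.mem_carrier[OF C_subgroup] by blast
  have TH: "set ws \<subseteq> H" "set t \<subseteq> H" "set rs \<subseteq> H"
    using S(2) unfolding S_eq by (auto simp flip: ws(1) t rs)
  then have sub: "set ws \<subseteq> carrier G" "set t \<subseteq> carrier G" "set rs \<subseteq> carrier G"
    using H_sub by auto
  have rH: "list_prod rs \<in> H" using TH list_prod_in_subgroup[OF H] by blast
  have "list_prod t \<otimes> k \<in> prods T" using full k(1) t by (auto simp: prods_def)
  then obtain t' where t': "mset t' = T" "list_prod t' = list_prod t \<otimes> k"
    by (auto simp: prods_def)
  have t'G: "set t' \<subseteq> carrier G" using sub(2) t t'(1) by (metis set_mset_mset)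
  have "list_prod (t' @ rs) = list_prod t \<otimes> (k \<otimes> list_prod rs)"
    using sub t'G kG by (simp add: t'(2) m_assoc)
  \<comment> \<open>\<open>k\<close> commutes with \<open>list_prod rs\<close>, and
    \<open>ws\<close> contributes only \<open>\<one>\<close>.\<close>
  also have "\<dots> = list_prod xs"
    using sub kG ws(2) C_central[OF _ rH, of k] K k(1) by (auto simp: k(2) m_assoc)
  finally have "product_one G (T + R)"
    unfolding product_one_iff using t'(1) rs xs(2) t'G sub
    by (intro conjI exI[of _ "t' @ rs"]) (auto simp flip: t'(1) rs)
  then show False
    using S(1) S_eq W T(2) unfolding minimal_product_one_def
    by (metis add_cancel_right_right subset_mset.add_eq_0_iff_both_eq_0 union_eq_empty)
qed

text \<open>The \<open>p + 1\<close> linear forms whose kernels are the lines of \<open>(\<int>/p)\<^sup>2\<close>.\<close>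

definition direction :: "nat \<Rightarrow> 'a \<Rightarrow> int" where
  "direction r g = (if r < p then \<beta> g - int r * \<alpha> g else \<alpha> g)"

text \<open>If \<open>p\<close> divides \<open>\<alpha> g\<close>, the form of index
  \<open>p\<close> vanishes on \<open>g\<close>; otherwise \<open>r\<close> is the slope, the
  quotient of \<open>\<beta> g\<close> by \<open>\<alpha> g\<close> modulo \<open>p\<close>.\<close>

lemma exists_direction:
  obtains r where "r \<le> p" "int p dvd direction r g"
proof (cases "int p dvd \<alpha> g")
  case True
  then show ?thesis using that[of p] by (simp add: direction_def)
next
  case False
  then have "coprime (\<alpha> g) (int p)"
    using p prime_imp_coprime[of "int p" "\<alpha> g"] by (simp add: coprime_commute)
  then obtain y where y: "[\<alpha> g * y = 1] (mod int p)" using cong_solve_coprime_int by blast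
  define r where "r = nat ((\<beta> g * y) mod int p)"
  have r: "int r = (\<beta> g * y) mod int p" "r < p"
    using p_gt_1 by (simp_all add: r_def nat_less_iff)
  have "[int r * \<alpha> g = \<beta> g * y * \<alpha> g] (mod int p)"
    unfolding r(1) by (simp add: cong_def mod_simps)
  also have "\<beta> g * y * \<alpha> g = \<beta> g * (\<alpha> g * y)" by simp
  also have "[\<dots> = \<beta> g * 1] (mod int p)" by (intro cong_scalar_left y)
  finally have "int p dvd \<beta> g - int r * \<alpha> g"
    by (simp add: cong_iff_dvd_diff dvd_diff_commute)
  then show ?thesis using that[of r] r(2) by (simp add: direction_def)
qed

text \<open>Two vectors on a common line have determinant zero.\<close>

lemma commute_if_same_direction:
  assumes "g \<in> H" "h \<in> H" "int p dvd direction r g" "int p dvd direction r h"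
  shows "g \<otimes> h = h \<otimes> g"
proof -
  have "\<beta> g * \<alpha> h - \<alpha> g * \<beta> h =
      (\<beta> g - int r * \<alpha> g) * \<alpha> h - \<alpha> g * (\<beta> h - int r * \<alpha> h)" by (simp add: algebra_simps)
  then have "int p dvd \<beta> g * \<alpha> h - \<alpha> g * \<beta> h"
    using assms(3,4) by (cases "r < p") (auto simp: direction_def intro: dvd_diff)
  then show ?thesis using commute_iff assms by blast
qed

text \<open>A non-zero vector on a line and a vector off that line are linearly independent, so
  their determinant is non-zero modulo \<open>p\<close>.\<close>

lemma not_commute_if_other_direction:
  assumes "g \<in> H" "h \<in> H" "g \<notin> Z" "int p dvd direction r g" "\<not> int p dvd direction r h"
  shows "g \<otimes> h \<noteq> h \<otimes> g"
proof
  assume "g \<otimes> h = h \<otimes> g"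
  then have d: "int p dvd \<beta> g * \<alpha> h - \<alpha> g * \<beta> h" using commute_iff assms by blast
  have pr: "Factorial_Ring.prime (int p)" using p by simp
  show False
  proof (cases "r < p")
    case True
    have "\<alpha> g * (\<beta> h - int r * \<alpha> h) =
        (\<beta> g - int r * \<alpha> g) * \<alpha> h - (\<beta> g * \<alpha> h - \<alpha> g * \<beta> h)" by (simp add: algebra_simps)
    then have "int p dvd \<alpha> g * (\<beta> h - int r * \<alpha> h)"
      using d assms(4) True by (simp add: direction_def)
    then have "int p dvd \<alpha> g"
      using assms(5) True pr by (auto simp: direction_def prime_dvd_mult_iff)
    moreover from this have "int p dvd \<beta> g"
      using assms(4) True by (auto simp: direction_def intro: dvd_if_dvd_diff)
    ultimately show False using assms(1,3) by (simp add: Z_def)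
  next
    case False
    then have "int p dvd \<alpha> g" "\<not> int p dvd \<alpha> h" using assms(4,5) by (auto simp: direction_def)
    moreover from this have "int p dvd \<beta> g * \<alpha> h"
      using d by (auto intro: dvd_if_dvd_diff)
    ultimately show False using assms(1,3) pr by (simp add: Z_def prime_dvd_mult_iff)
  qed
qed

theorem minimal_product_one_size_le:
  assumes S: "minimal_product_one G S" "set_mset S \<subseteq> H" and q: "card Z \<ge> p"
  shows "size S \<le> card Z * p + 2 * p - 2"
proof (rule ccontr)
  assume "\<not> ?thesis"
  then have large: "size S \<ge> card Z * p + 2 * p - 1" by simp
  have "card Z * 2 \<le> card Z * p" using p_gt_1 by (intro mult_le_mono2) simp
  then have "size S > card Z" using large p_gt_1 by linarith
  then have few: "size {#g \<in># S. g \<in> Z#} < card Z" using few_kernel_terms S by blast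
  define N where "N = {#g \<in># S. g \<notin> Z#}"
  have "size S = size {#g \<in># S. g \<in> Z#} + size N"
    unfolding N_def size_union[symmetric] by (simp flip: multiset_partition)
  then have "size N + card Z \<ge> card Z * p + 2 * p" using few large by linarith
  moreover have "card Z * p = card Z * (p - 1) + card Z"
    using p_gt_1 by (cases p) auto
  \<comment> \<open>Here \<open>card Z \<ge> p\<close> enters: it leaves more than
    \<open>p * p\<close> terms outside \<open>Z\<close>.\<close>
  moreover have "p * (p - 1) \<le> card Z * (p - 1)" using q by (rule mult_le_mono1)
  ultimately have "size N > p * (p - 1) + p" using p_gt_1 by linarith
  then have N: "size N > p * p" using p_gt_1 by (cases p) auto
  \<comment> \<open>With at most \<open>p - 2\<close> terms on each of the \<open>p + 1\<close>
    lines there would be at most \<open>(p + 1) * (p - 2)\<close> terms, which is less than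
    \<open>p * p\<close>.\<close>
  have "\<exists>r\<le>p. size {#g \<in># N. int p dvd direction r g#} \<ge> p - 1"
  proof (rule ccontr)
    assume "\<not> ?thesis"
    then have le: "size {#g \<in># N. int p dvd direction r g#} \<le> p - 2" if "r \<in> {..p}" for r
      using that by force
    have "size N \<le> (\<Sum>r\<in>{..p}. size {#g \<in># N. int p dvd direction r g#})"
      by (intro size_le_sum_size_filter) (simp, metis atMost_iff exists_direction)
    also have "\<dots> \<le> (p + 1) * (p - 2)"
      using sum_bounded_above[of "{..p}" _ "p - 2", OF le] by simp
    also have "\<dots> \<le> p * p" using p_gt_1 by (cases p; cases "p - 1") (auto simp: algebra_simps)
    finally show False using N by simp
  qed
  then obtain r where "size {#g \<in># N. int p dvd direction r g#} \<ge> p - 1" by blast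
  then obtain A where A: "A \<subseteq># {#g \<in># N. int p dvd direction r g#}" "size A = p - 1"
    using exists_subset_mset_size by blast
  have AN: "a \<in># S \<and> a \<notin> Z \<and> int p dvd direction r a" if "a \<in># A" for a
    using mset_subset_eqD[OF A(1) that] by (simp add: N_def)
  then have AH: "set_mset A \<subseteq> H" using S(2) by auto
  show False
  proof (cases "\<exists>h. h \<in># S \<and> \<not> int p dvd direction r h")
    case True
    then obtain h where h: "h \<in># S" "\<not> int p dvd direction r h" by blast
    have hH: "h \<in> H" using h S(2) by auto
    \<comment> \<open>\<open>A\<close> lies on the line and \<open>h\<close> off it, so both can be
      taken from \<open>S\<close> together, whatever the multiplicities.\<close>
    have "A \<subseteq># {#g \<in># S. int p dvd direction r g#}"
      using A(1) unfolding N_def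
      by (meson multiset_filter_mono multiset_filter_subset subset_mset.trans)
    moreover have "{#h#} \<subseteq># {#g \<in># S. \<not> int p dvd direction r g#}" using h by simp
    ultimately have "A + {#h#} \<subseteq># S"
      by (subst multiset_partition[of S "\<lambda>g. int p dvd direction r g"]) (rule subset_mset.add_mono)
    then have sub: "add_mset h A \<subseteq># S" by simp
    have "size (S - add_mset h A) < card Z * p + p - 1"
    proof (rule size_rest_less[OF S sub])
      show "\<exists>k\<in>C. list_prod xs = list_prod ys \<otimes> k" if "mset xs = S" "mset ys = S" for xs ys
        using that S(2) by (intro list_prod_permute_H) auto
      show "g \<otimes> k \<in> prods (add_mset h A)" if "g \<in> prods (add_mset h A)" "k \<in> C" for g k
        using AN AH hH that A(2)
        by (intro prods_full commute_if_same_direction[of _ _ r] not_commute_if_other_direction[of _ _ r] h) auto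
    qed auto
    \<comment> \<open>Removing these \<open>p\<close> terms leaves at least
      \<open>card Z * p + p - 1\<close>.\<close>
    then show False using large A(2) sub p_gt_1 by (simp add: size_Diff_submset)
  next
    case False
    \<comment> \<open>All terms lie on one line and hence commute, so every ordering of
      \<open>S\<close> has the same product. A single term \<open>x\<close> then serves as
      \<open>T\<close>, with the trivial subgroup in place of \<open>C\<close>.\<close>
    then have comm: "g \<otimes> h = h \<otimes> g" if "g \<in># S" "h \<in># S" for g h
      using that S(2) commute_if_same_direction[of g h r] by auto
    obtain x where x: "x \<in># S" using large p_gt_1 by (cases S) auto
    have SG: "set_mset S \<subseteq> carrier G" using S(2) H_sub by auto
    have "size (S - {#x#}) < card Z * p + p - 1"
    proof (rule size_rest_less[OF S, where K = "{\<one>}"])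
      show "\<exists>k\<in>{\<one>}. list_prod xs = list_prod ys \<otimes> k" if "mset xs = S" "mset ys = S" for xs ys
        using that SG comm triv_subgroup
        by (intro list_prod_permute[where A = "set_mset S"]) (auto simp: subset_iff)
      show "g \<otimes> k \<in> prods {#x#}" if "g \<in> prods {#x#}" "k \<in> {\<one>}" for g k
      proof -
        have "prods {#x#} \<subseteq> carrier G" using prods_sub[of "{#x#}"] x S(2) H_sub by auto
        then show ?thesis using that by auto
      qed
    qed (use x subgroup.one_closed[OF C_subgroup] in auto)
    then show False using large x p_gt_1 by (simp add: size_Diff_singleton)
  qed
qed

end

section \<open>Central commutators in non-abelian \<open>p\<close>-groups\<close>

text \<open>Orbit sizes divide \<open>p ^ n\<close>, so every orbit that is not a singleton has size
  divisible by \<open>p\<close>; these orbits partition the complement of the fixed points.\<close>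

lemma (in group_action) p_dvd_card_fixed_points:
  assumes p: "Factorial_Ring.prime p" and ord: "order G = p ^ n"
    and E: "finite E" "p dvd card E"
  shows "p dvd card {x \<in> E. \<forall>g\<in>carrier G. \<phi> g x = x}"
proof -
  let ?F = "{x \<in> E. \<forall>g\<in>carrier G. \<phi> g x = x}"
  let ?O = "{orb \<in> orbits G E \<phi>. card orb \<noteq> 1}"
  have sub: "orbit G \<phi> x \<subseteq> E" if "x \<in> E" for x
    using that element_image by (auto simp: orbit_def)
  have one: "card (orbit G \<phi> x) = 1 \<longleftrightarrow> x \<in> ?F" if x: "x \<in> E" for x
  proof
    assume "card (orbit G \<phi> x) = 1"
    then have "orbit G \<phi> x = {x}" using orbit_refl[OF x] by (auto simp: card_1_singleton_iff)
    then show "x \<in> ?F" using x by (auto simp: orbit_def)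
  next
    assume "x \<in> ?F"
    then have "orbit G \<phi> x = {x}" using orbit_refl[OF x] by (auto simp: orbit_def)
    then show "card (orbit G \<phi> x) = 1" by simp
  qed
  have "E - ?F = \<Union>?O"
  proof
    show "E - ?F \<subseteq> \<Union>?O"
    proof
      fix x assume x: "x \<in> E - ?F"
      then have "orbit G \<phi> x \<in> ?O" using one[of x] by (auto simp: orbits_def)
      then show "x \<in> \<Union>?O" using orbit_refl[of x] x by blast
    qed
    show "\<Union>?O \<subseteq> E - ?F"
    proof
      fix y assume "y \<in> \<Union>?O"
      then obtain orb where o: "orb \<in> orbits G E \<phi>" "card orb \<noteq> 1" "y \<in> orb" by blast
      then have yE: "y \<in> E" using orbits_coverture by blast
      then have "orbit G \<phi> y \<in> orbits G E \<phi>" by (auto simp: orbits_def)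
      then have "orbit G \<phi> y = orb" using disjoint_union[OF o(1)] o(3) orbit_refl[OF yE] by blast
      then show "y \<in> E - ?F" using o(2) one[OF yE] yE by simp
    qed
  qed
  moreover have "p dvd card (\<Union>?O)"
  proof (rule dvd_partition)
    have "\<Union>?O \<subseteq> \<Union>(orbits G E \<phi>)" by blast
    then show "finite (\<Union>?O)" using E(1) unfolding orbits_coverture by (rule finite_subset)
    show "\<forall>orb\<in>?O. p dvd card orb"
    proof
      fix orb assume orb: "orb \<in> ?O"
      then obtain x where x: "x \<in> E" "orb = orbit G \<phi> x" by (auto simp: orbits_def)
      have "card orb dvd p ^ n"
        using orbit_stabilizer_theorem[OF x(1)] ord x(2) by (metis dvd_triv_left)
      then obtain i where "card orb = p ^ i" using p by (auto simp: divides_primepow_nat)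
      then show "p dvd card orb" using orb by (cases i) auto
    qed
    show "\<forall>c1\<in>?O. \<forall>c2\<in>?O. c1 \<noteq> c2 \<longrightarrow> c1 \<inter> c2 = {}"
      using disjoint_union by blast
  qed
  ultimately have "p dvd card (E - ?F)" by simp
  moreover have "card E = card (E - ?F) + card ?F"
    using E(1) card_Diff_subset[of ?F E] card_mono[of E ?F] by auto
  ultimately show ?thesis using E(2) dvd_add_right_iff[of p "card (E - ?F)" "card ?F"] by argo
qed

definition center :: "('a, 'b) monoid_scheme \<Rightarrow> 'a set" where
  "center G = {z \<in> carrier G. \<forall>g\<in>carrier G. z \<otimes>\<^bsub>G\<^esub> g = g \<otimes>\<^bsub>G\<^esub> z}"

context group
begin

lemma center_closed [simp]: "z \<in> center G \<Longrightarrow> z \<in> carrier G"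
  unfolding center_def by blast

lemma center_commutes: "z \<in> center G \<Longrightarrow> g \<in> carrier G \<Longrightarrow> z \<otimes> g = g \<otimes> z"
  unfolding center_def by blast

lemma center_subgroup: "subgroup (center G) G"
proof (rule subgroupI)
  fix a assume a: "a \<in> center G"
  have "inv a \<otimes> g = g \<otimes> inv a" if g: "g \<in> carrier G" for g
  proof -
    have "inv a \<otimes> g = inv a \<otimes> (g \<otimes> a) \<otimes> inv a" using a g by (simp add: m_assoc)
    also have "\<dots> = inv a \<otimes> (a \<otimes> g) \<otimes> inv a" using center_commutes[OF a g] by simp
    also have "\<dots> = g \<otimes> inv a" using a g by (simp flip: m_assoc)
    finally show ?thesis .
  qed
  then show "inv a \<in> center G"
    using inv_closed[OF center_closed[OF a]] unfolding center_def by blast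
next
  fix a b assume ab: "a \<in> center G" "b \<in> center G"
  have "a \<otimes> b \<otimes> g = g \<otimes> (a \<otimes> b)" if g: "g \<in> carrier G" for g
  proof -
    have "a \<otimes> b \<otimes> g = a \<otimes> (g \<otimes> b)" using ab g center_commutes[of b g] by (simp add: m_assoc)
    also have "\<dots> = g \<otimes> (a \<otimes> b)" using ab g center_commutes[of a g] by (simp flip: m_assoc)
    finally show ?thesis .
  qed
  then show "a \<otimes> b \<in> center G"
    using m_closed[OF ab[THEN center_closed]] unfolding center_def by blast
next
  show "center G \<subseteq> carrier G" using center_closed by blast
  have "\<one> \<in> center G" unfolding center_def by simp
  then show "center G \<noteq> {}" by blast
qed

lemma center_normal: "center G \<lhd> G"
proof (rule normalI[OF center_subgroup], rule ballI)
  show "center G #> g = g <# center G" if "g \<in> carrier G" for g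
    unfolding r_coset_def l_coset_def using center_commutes[OF _ that] by (intro SUP_cong) auto
qed

text \<open>The centre is the set of fixed points of conjugation, so \<open>p\<close> divides its
  order.\<close>

lemma p_group_center_nontrivial:
  assumes p: "Factorial_Ring.prime p" and ord: "order G = p ^ n" "n > 0"
  shows "\<exists>z\<in>center G. z \<noteq> \<one>"
proof (rule ccontr)
  assume "\<not> ?thesis"
  then have triv: "center G = {\<one>}" using subgroup.one_closed[OF center_subgroup] by blast
  have fin: "finite (carrier G)" using ord p order_gt_0_iff_finite by (simp add: prime_gt_0_nat)
  interpret conj: group_action G "carrier G" "\<lambda>g. \<lambda>h\<in>carrier G. g \<otimes> h \<otimes> inv g"
    by (rule action_by_conjugation)
  have "p dvd card {x \<in> carrier G. \<forall>g\<in>carrier G. (\<lambda>h\<in>carrier G. g \<otimes> h \<otimes> inv g) x = x}"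
    using ord by (intro conj.p_dvd_card_fixed_points[OF p ord(1) fin]) (simp flip: order_def)
  also have "{x \<in> carrier G. \<forall>g\<in>carrier G. (\<lambda>h\<in>carrier G. g \<otimes> h \<otimes> inv g) x = x} = center G"
  proof -
    have "g \<otimes> x \<otimes> inv g = x \<longleftrightarrow> x \<otimes> g = g \<otimes> x" if "x \<in> carrier G" "g \<in> carrier G" for x g
      using that inv_solve_right'[of x "g \<otimes> x" g] by auto
    then show ?thesis unfolding center_def by auto
  qed
  finally show False using triv p by simp
qed

section \<open>Bilinearity of central commutators\<close>

text \<open>\<open>d\<close> is the commutator
  \<open>inv a \<otimes> inv b \<otimes> a \<otimes> b\<close>, required to be central. With a
  relation, bilinearity takes the form of introduction rules.\<close>

definition twist :: "'a \<Rightarrow> 'a \<Rightarrow> 'a \<Rightarrow> bool" where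
  "twist a b d \<longleftrightarrow> a \<in> carrier G \<and> b \<in> carrier G \<and> d \<in> center G \<and> a \<otimes> b = b \<otimes> a \<otimes> d"

text \<open>\<open>x\<close> lifts a non-trivial central element of the quotient by the centre, so
  its commutators are central; as \<open>x\<close> is not central itself, one of them is
  non-trivial.\<close>

lemma p_group_exists_central_commutator:
  assumes p: "Factorial_Ring.prime p" and ord: "order G = p ^ n"
    and "\<not> comm_group G"
  obtains x y d where "twist y x d" "d \<noteq> \<one>"
proof -
  interpret Z: normal "center G" G by (rule center_normal)
  interpret Q: group "G Mod center G" by (rule Z.factorgroup_is_group)
  have oQ: "order (G Mod center G) = card (rcosets center G)"
    by (simp add: order_def FactGroup_def)
  then have "order (G Mod center G) dvd p ^ n"
    using lagrange[OF center_subgroup] unfolding ord by (metis dvd_triv_left)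
  then obtain m where m: "order (G Mod center G) = p ^ m" using divides_primepow_nat[OF p] by blast
  have "center G \<noteq> carrier G"
  proof
    assume eq: "center G = carrier G"
    have "comm_group G" using center_commutes unfolding eq by (rule group_comm_groupI)
    then show False using assms(3) by simp
  qed
  moreover have fin: "finite (carrier G)"
    using ord p order_gt_0_iff_finite by (simp add: prime_gt_0_nat)
  ultimately have "card (center G) < order G"
    unfolding order_def using subgroup.subset[OF center_subgroup] by (intro psubset_card_mono) blast+
  then have "m > 0" using m oQ lagrange[OF center_subgroup] by (cases m) auto
  then obtain K where K: "K \<in> center (G Mod center G)" "K \<noteq> \<one>\<^bsub>G Mod center G\<^esub>"
    using Q.p_group_center_nontrivial[OF p m] by blast
  have "K \<in> rcosets center G" using K(1) unfolding center_def FactGroup_def by simp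
  then obtain x where x: "x \<in> carrier G" "K = center G #> x" unfolding RCOSETS_def by blast
  have "x \<notin> center G"
    using K(2) x coset_join2[OF x(1) center_subgroup] by (auto simp: FactGroup_def)
  then obtain y where y: "y \<in> carrier G" "x \<otimes> y \<noteq> y \<otimes> x" using x(1) unfolding center_def by blast
  have "K <#> (center G #> y) = (center G #> y) <#> K"
    using K(1)
    unfolding center_def[of "G Mod center G"] by (simp add: carrier_FactGroup y(1))
  then have "center G #> (x \<otimes> y) = center G #> (y \<otimes> x)"
    using x y by (simp add: Z.rcos_sum)
  then have "y \<otimes> x \<in> center G #> (x \<otimes> y)"
    using x y rcos_self[OF _ center_subgroup] by simp
  then obtain d where d: "d \<in> center G" "y \<otimes> x = d \<otimes> (x \<otimes> y)" by (auto simp: r_coset_def)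
  then have "twist y x d" using x y center_commutes[of d "x \<otimes> y"] by (simp add: twist_def)
  moreover have "d \<noteq> \<one>" using y x d by auto
  ultimately show ?thesis using that by blast
qed

lemma center_pow_closed: "d \<in> center G \<Longrightarrow> d [^] (n::nat) \<in> center G"
  by (induction n) (simp_all add: subgroup.one_closed[OF center_subgroup] subgroup.m_closed[OF center_subgroup])

lemma twist_self: "a \<in> carrier G \<Longrightarrow> twist a a \<one>"
  by (simp add: twist_def subgroup.one_closed[OF center_subgroup])

lemma twist_central:
  assumes "a \<in> carrier G" "z \<in> center G" shows "twist a z \<one>" "twist z a \<one>"
  using assms center_commutes[of z a]
  by (simp_all add: twist_def subgroup.one_closed[OF center_subgroup])

lemma twist_mult_right:
  assumes "twist a b d" "twist a b' d'" shows "twist a (b \<otimes> b') (d \<otimes> d')"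
proof -
  have cl: "a \<in> carrier G" "b \<in> carrier G" "b' \<in> carrier G" "d \<in> center G" "d' \<in> center G"
    and e: "a \<otimes> b = b \<otimes> a \<otimes> d" "a \<otimes> b' = b' \<otimes> a \<otimes> d'"
    using assms by (auto simp: twist_def)
  have "a \<otimes> (b \<otimes> b') = b \<otimes> a \<otimes> (d \<otimes> b')" using cl by (simp add: e m_assoc flip: m_assoc[of a b b'])
  also have "\<dots> = b \<otimes> (a \<otimes> b') \<otimes> d" using cl center_commutes[of d b'] by (simp add: m_assoc)
  also have "\<dots> = b \<otimes> b' \<otimes> a \<otimes> (d' \<otimes> d)" using cl by (simp add: e m_assoc)
  also have "d' \<otimes> d = d \<otimes> d'" using cl center_commutes by simp
  finally show ?thesis using cl by (simp add: twist_def subgroup.m_closed[OF center_subgroup])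
qed

lemma twist_sym:
  assumes "twist a b d" shows "twist b a (inv d)"
proof -
  have cl: "a \<in> carrier G" "b \<in> carrier G" "d \<in> center G" and e: "a \<otimes> b = b \<otimes> a \<otimes> d"
    using assms by (auto simp: twist_def)
  have "a \<otimes> b \<otimes> inv d = b \<otimes> a" using cl by (simp add: e m_assoc)
  then show ?thesis using cl by (simp add: twist_def subgroup.m_inv_closed[OF center_subgroup])
qed

lemma twist_mult_left:
  assumes "twist a b d" "twist a' b d'" shows "twist (a \<otimes> a') b (d \<otimes> d')"
proof -
  have cl: "d \<in> center G" "d' \<in> center G" using assms by (auto simp: twist_def)
  have "twist (a \<otimes> a') b (inv (inv d \<otimes> inv d'))"
    using assms by (intro twist_sym twist_mult_right)
  moreover have "inv (inv d \<otimes> inv d') = d \<otimes> d'"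
    using cl center_commutes[of d d'] by (simp add: inv_mult_group)
  ultimately show ?thesis by simp
qed

lemma twist_pow_right: "twist a b d \<Longrightarrow> twist a (b [^] (n::nat)) (d [^] n)"
proof (induction n)
  case 0
  then show ?case
    using twist_central(1)[of a \<one>] subgroup.one_closed[OF center_subgroup] by (simp add: twist_def)
qed (simp add: twist_mult_right)

lemma twist_pow_left: "twist a b d \<Longrightarrow> twist (a [^] (n::nat)) b (d [^] n)"
proof (induction n)
  case 0
  then show ?case
    using twist_central(2)[of b \<one>] subgroup.one_closed[OF center_subgroup] by (simp add: twist_def)
qed (simp add: twist_mult_left)

lemma twist_unique: "twist a b d \<Longrightarrow> twist a b d' \<Longrightarrow> d = d'"
  by (auto simp: twist_def)

text \<open>Replacing \<open>x\<close> by a power makes the commutator have order \<open>p\<close>.\<close>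

lemma p_group_exists_twist:
  assumes p: "Factorial_Ring.prime p" and ord: "order G = p ^ n" and "\<not> comm_group G"
  obtains x y c where "twist y x c" "c \<noteq> \<one>" "c [^] p = \<one>"
proof -
  obtain x y d where d: "twist y x d" "d \<noteq> \<one>"
    using p_group_exists_central_commutator[OF assms] by blast
  have dG: "d \<in> carrier G" using d(1) by (simp add: twist_def)
  define e where "e = (LEAST e. d [^] (p ^ e) = \<one>)"
  have "d [^] (p ^ n) = \<one>" using pow_order_eq_1[OF dG] ord by simp
  then have e: "d [^] (p ^ e) = \<one>" unfolding e_def by (rule LeastI)
  have "e \<noteq> 0" using e d(2) dG by (intro notI) simp
  then obtain e' where e': "e = Suc e'" using not0_implies_Suc by blast
  have "d [^] (p ^ e') \<noteq> \<one>" using not_less_Least[of e' "\<lambda>e. d [^] (p ^ e) = \<one>"] e' by (simp add: e_def)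
  moreover have "(d [^] (p ^ e')) [^] p = \<one>" using e e' dG by (simp add: nat_pow_pow mult.commute)
  ultimately show ?thesis using that twist_pow_right[OF d(1)] by blast
qed

end

section \<open>The subgroup generated by \<open>x\<close> and \<open>y\<close>\<close>

locale twisted_pair = group G for G (structure) +
  fixes x y c :: 'a and p :: nat
  assumes finite_carrier: "finite (carrier G)" and prime_p: "Factorial_Ring.prime p"
    and xy: "twist y x c" and c_ne: "c \<noteq> \<one>" and c_p: "c [^] p = \<one>"
begin

lemma xyc [simp]: "x \<in> carrier G" "y \<in> carrier G" "c \<in> carrier G" and c_center: "c \<in> center G"
  using xy by (auto simp: twist_def)

text \<open>This is the subgroup generated by \<open>x\<close> and \<open>y\<close>: moving
  \<open>y\<close> past \<open>x\<close> costs the central element \<open>c\<close>, and natural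
  exponents suffice since the group is finite.\<close>

definition H where "H = {x [^] (i::nat) \<otimes> y [^] (j::nat) \<otimes> c [^] (k::nat) | i j k. True}"

text \<open>The exponent of \<open>x\<close> modulo \<open>p\<close>, read off from the commutator
  with \<open>y\<close>. This does not depend on how \<open>g\<close> is written, whereas the
  exponents in \<open>H\<close> are not unique.\<close>

definition \<alpha> where "\<alpha> g = int (SOME a. twist y g (c [^] (a::nat)))"

definition \<beta> where "\<beta> g = int (SOME b. twist g x (c [^] (b::nat)))"

lemma twist_H:
  fixes i j k :: nat
  shows "twist y (x [^] i \<otimes> y [^] j \<otimes> c [^] k) (c [^] i)"
    and "twist (x [^] i \<otimes> y [^] j \<otimes> c [^] k) x (c [^] j)"
proof -
  have "twist y (x [^] i \<otimes> y [^] j \<otimes> c [^] k) (c [^] i \<otimes> \<one> [^] j \<otimes> \<one> [^] k)"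
    by (intro twist_mult_right twist_pow_right xy twist_self twist_central c_center) simp_all
  then show "twist y (x [^] i \<otimes> y [^] j \<otimes> c [^] k) (c [^] i)" by simp
  have "twist (x [^] i \<otimes> y [^] j \<otimes> c [^] k) x (\<one> [^] i \<otimes> c [^] j \<otimes> \<one> [^] k)"
    by (intro twist_mult_left twist_pow_left xy twist_self twist_central c_center) simp_all
  then show "twist (x [^] i \<otimes> y [^] j \<otimes> c [^] k) x (c [^] j)" by simp
qed

lemma H_sub_carrier: "H \<subseteq> carrier G" by (auto simp: H_def)

lemma H_mult: assumes "g \<in> H" "h \<in> H" shows "g \<otimes> h \<in> H"
proof -
  obtain i j k i' j' k' :: nat where g: "g = x [^] i \<otimes> y [^] j \<otimes> c [^] k"
    and h: "h = x [^] i' \<otimes> y [^] j' \<otimes> c [^] k'" using assms by (auto simp: H_def)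
  define d where "d = (c [^] i') [^] j"
  have "twist (y [^] j) (x [^] i') d"
    unfolding d_def by (intro twist_pow_left twist_pow_right xy)
  then have tw: "y [^] j \<otimes> x [^] i' = x [^] i' \<otimes> y [^] j \<otimes> d" and d: "d \<in> center G"
    by (auto simp: twist_def)
  have dk: "d \<in> carrier G" "c [^] k \<in> center G" using d center_pow_closed[OF c_center] by auto
  have "g \<otimes> h = x [^] i \<otimes> y [^] j \<otimes> (c [^] k \<otimes> (x [^] i' \<otimes> y [^] j')) \<otimes> c [^] k'"
    by (simp add: g h m_assoc)
  also have "\<dots> = x [^] i \<otimes> (y [^] j \<otimes> x [^] i') \<otimes> y [^] j' \<otimes> c [^] k \<otimes> c [^] k'"
    using center_commutes[OF dk(2), of "x [^] i' \<otimes> y [^] j'"] by (simp add: m_assoc)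
  also have "\<dots> = x [^] i \<otimes> x [^] i' \<otimes> y [^] j \<otimes> (d \<otimes> y [^] j') \<otimes> c [^] k \<otimes> c [^] k'"
    using dk by (simp add: tw m_assoc)
  also have "\<dots> = (x [^] i \<otimes> x [^] i') \<otimes> (y [^] j \<otimes> y [^] j') \<otimes> (d \<otimes> c [^] k \<otimes> c [^] k')"
    using dk center_commutes[OF d, of "y [^] j'"] by (simp add: m_assoc)
  also have "\<dots> = x [^] (i + i') \<otimes> y [^] (j + j') \<otimes> c [^] (i' * j + k + k')"
    by (simp add: d_def nat_pow_mult nat_pow_pow)
  finally show ?thesis unfolding H_def by blast
qed

lemma H_memI: "x [^] i \<otimes> y [^] j \<otimes> c [^] k \<in> H" for i j k :: nat
  unfolding H_def by blast

lemma x_in_H: "x \<in> H" and y_in_H: "y \<in> H" and c_pow_H: "c [^] (k::nat) \<in> H" and one_H: "\<one> \<in> H"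
  using H_memI[of 1 0 0] H_memI[of 0 1 0] H_memI[of 0 0 k] H_memI[of 0 0 0] by simp_all

lemma pow_H: "g \<in> H \<Longrightarrow> g [^] (n::nat) \<in> H"
  by (induction n) (simp_all add: one_H H_mult)

lemma subgroup_H: "subgroup H G"
proof (rule subgroupI)
  show "H \<subseteq> carrier G" by (rule H_sub_carrier)
  show "H \<noteq> {}" using one_H by blast
  show "g \<otimes> h \<in> H" if "g \<in> H" "h \<in> H" for g h using that by (rule H_mult)
  show "inv g \<in> H" if g: "g \<in> H" for g
  proof -
    have gG: "g \<in> carrier G" using g H_sub_carrier by blast
    have "order G > 0" using finite_carrier order_gt_0_iff_finite by simp
    then have "g [^] (order G - 1) \<otimes> g = \<one>"
      using pow_order_eq_1[OF gG] nat_pow_Suc[of g "order G - 1"] by simp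
    then have "inv g = g [^] (order G - 1)" using gG by (intro inv_equality) auto
    then show ?thesis using pow_H[OF g] by simp
  qed
qed

lemma twist_\<alpha>: assumes "g \<in> H" shows "twist y g (c [^] \<alpha> g)"
proof -
  have "\<exists>a::nat. twist y g (c [^] a)" using assms twist_H(1) by (auto simp: H_def)
  then have "twist y g (c [^] (SOME a::nat. twist y g (c [^] a)))" by (rule someI_ex)
  then show ?thesis by (simp add: \<alpha>_def int_pow_int)
qed

lemma twist_\<beta>: assumes "g \<in> H" shows "twist g x (c [^] \<beta> g)"
proof -
  have "\<exists>b::nat. twist g x (c [^] b)" using assms twist_H(2) by (auto simp: H_def)
  then have "twist g x (c [^] (SOME b::nat. twist g x (c [^] b)))" by (rule someI_ex)
  then show ?thesis by (simp add: \<beta>_def int_pow_int)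
qed

lemma ord_c_eq: "ord c = p"
  using c_ne c_p pow_eq_id[of c p] prime_p pow_eq_id[of c 1] by (auto simp: prime_nat_iff)

lemma c_pow_eq_iff: "c [^] (i::int) = c [^] j \<longleftrightarrow> int p dvd i - j"
  using int_pow_eq[of c i j] by (simp add: ord_c_eq dvd_diff_commute)

lemma \<alpha>_unique: "g \<in> H \<Longrightarrow> twist y g (c [^] (i::int)) \<Longrightarrow> int p dvd \<alpha> g - i"
  using twist_unique[OF twist_\<alpha>, of g "c [^] i"] by (simp add: c_pow_eq_iff)

lemma \<beta>_unique: "g \<in> H \<Longrightarrow> twist g x (c [^] (i::int)) \<Longrightarrow> int p dvd \<beta> g - i"
  using twist_unique[OF twist_\<beta>, of g "c [^] i"] by (simp add: c_pow_eq_iff)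

sublocale commutator_pairing G H c p \<alpha> \<beta>
proof (rule commutator_pairing.intro[OF is_group], rule commutator_pairing_axioms.intro)
  show "subgroup H G" by (rule subgroup_H)
  show "finite H" using H_sub_carrier finite_carrier by (rule finite_subset)
  show "Factorial_Ring.prime p" "c \<noteq> \<one>" "c [^] p = \<one>" by (fact prime_p c_ne c_p)+
  show "c \<in> H" using c_pow_H[of 1] by simp
  show "c \<otimes> g = g \<otimes> c" if "g \<in> H" for g
    using that H_sub_carrier by (intro center_commutes[OF c_center]) auto
  show "int p dvd \<alpha> (g \<otimes> h) - (\<alpha> g + \<alpha> h)" if "g \<in> H" "h \<in> H" for g h
    using twist_mult_right[OF twist_\<alpha> twist_\<alpha>, OF that] H_mult[OF that]
    by (intro \<alpha>_unique) (simp_all add: int_pow_mult)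
  show "int p dvd \<beta> (g \<otimes> h) - (\<beta> g + \<beta> h)" if "g \<in> H" "h \<in> H" for g h
    using twist_mult_left[OF twist_\<beta> twist_\<beta>, OF that] H_mult[OF that]
    by (intro \<beta>_unique) (simp_all add: int_pow_mult)
  show "g \<otimes> h = h \<otimes> g \<otimes> c [^] (\<beta> g * \<alpha> h - \<alpha> g * \<beta> h)" if g: "g \<in> H" and h: "h \<in> H" for g h
  proof -
    obtain i j k :: nat where h': "h = x [^] i \<otimes> y [^] j \<otimes> c [^] k"
      using h unfolding H_def by blast
    have "int p dvd \<alpha> h - int i" "int p dvd \<beta> h - int j"
      using \<alpha>_unique[OF h] \<beta>_unique[OF h] twist_H[where i = i and j = j and k = k]
      by (simp_all add: h' int_pow_int)
    then have "int p dvd \<beta> g * (\<alpha> h - int i) - \<alpha> g * (\<beta> h - int j)" by (metis dvd_diff dvd_mult)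
    then have d: "int p dvd (\<beta> g * int i - \<alpha> g * int j) - (\<beta> g * \<alpha> h - \<alpha> g * \<beta> h)"
      by (subst dvd_diff_commute) (simp add: algebra_simps)
    \<comment> \<open>By bilinearity the commutator of \<open>g\<close> and \<open>h\<close> is the
      \<open>i\<close>-th power of the one with \<open>x\<close> times the \<open>j\<close>-th power
      of the one with \<open>y\<close>. The latter is inverted because \<open>\<alpha>\<close> takes
      \<open>y\<close> as first argument.\<close>
    have "twist g h ((c [^] \<beta> g) [^] i \<otimes> (inv (c [^] \<alpha> g)) [^] j \<otimes> \<one> [^] k)"
      unfolding h' using g H_sub_carrier
      by (intro twist_mult_right twist_pow_right twist_\<beta> twist_sym[OF twist_\<alpha>] twist_central c_center) auto
    moreover have "(c [^] \<beta> g) [^] i \<otimes> (inv (c [^] \<alpha> g)) [^] j \<otimes> \<one> [^] k =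
        c [^] (\<beta> g * int i - \<alpha> g * int j)"
      using int_pow_mult[of c "\<beta> g * int i" "- (\<alpha> g * int j)"]
      by (simp add: int_pow_pow flip: int_pow_int int_pow_neg)
    ultimately show ?thesis using d c_pow_eq_iff by (simp add: twist_def)
  qed
qed

lemma c_pow_inj:
  fixes m n :: nat
  assumes "c [^] m = c [^] n" "m < p" "n < p" shows "m = n"
proof -
  have "int p dvd int m - int n" using assms(1) c_pow_eq_iff[of "int m" "int n"] by (simp add: int_pow_int)
  then have "int m mod int p = int n mod int p" by (simp add: mod_eq_dvd_iff)
  then show ?thesis using assms(2,3) by simp
qed

text \<open>The powers of the central element \<open>c\<close> lie in \<open>Z\<close>, and
  \<open>p\<close> of them are distinct.\<close>

lemma p_le_card_Z: "p \<le> card Z"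
proof -
  have "c [^] n \<in> Z" for n :: nat
  proof -
    have "twist y (c [^] n) (c [^] (0::int))" "twist (c [^] n) x (c [^] (0::int))"
      using twist_central center_pow_closed[OF c_center] by simp_all
    then show ?thesis
      using \<alpha>_unique[OF c_pow_H, of n 0] \<beta>_unique[OF c_pow_H, of n 0] by (simp add: Z_def c_pow_H)
  qed
  moreover have "inj_on (\<lambda>n. c [^] n) {..<p}"
    using c_pow_inj by (auto intro!: inj_onI)
  ultimately show ?thesis
    using card_inj_on_le[of "\<lambda>n. c [^] n" "{..<p}" Z] finite_Z by auto
qed

text \<open>The products \<open>x [^] i \<otimes> y [^] j \<otimes> z\<close> with
  \<open>i, j < p\<close> and \<open>z\<close> in \<open>Z\<close> are distinct: commutators with
  \<open>y\<close> and \<open>x\<close> recover \<open>i\<close> and \<open>j\<close>, and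
  cancellation gives \<open>z\<close>.\<close>

lemma card_Z_mult_le: "p * p * card Z \<le> card H"
proof -
  let ?f = "\<lambda>(i::nat, j::nat, z). x [^] i \<otimes> y [^] j \<otimes> z"
  have tw: "twist y (x [^] i \<otimes> y [^] j \<otimes> z) (c [^] i)" "twist (x [^] i \<otimes> y [^] j \<otimes> z) x (c [^] j)"
    if z: "z \<in> Z" for i j :: nat and z
  proof -
    have "c [^] \<alpha> z = \<one>" "c [^] \<beta> z = \<one>" and zH: "z \<in> H" using z by (simp_all add: c_pow_eq_one Z_def)
    then have "twist y z \<one>" "twist z x \<one>" using twist_\<alpha>[OF zH] twist_\<beta>[OF zH] by simp_all
    then have "twist y (x [^] i \<otimes> y [^] j \<otimes> z) (c [^] i \<otimes> \<one> [^] j \<otimes> \<one>)"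
      "twist (x [^] i \<otimes> y [^] j \<otimes> z) x (\<one> [^] i \<otimes> c [^] j \<otimes> \<one>)"
      by (intro twist_mult_right twist_mult_left twist_pow_right twist_pow_left xy twist_self; simp)+
    then show "twist y (x [^] i \<otimes> y [^] j \<otimes> z) (c [^] i)" "twist (x [^] i \<otimes> y [^] j \<otimes> z) x (c [^] j)"
      by simp_all
  qed
  have "inj_on ?f ({..<p} \<times> {..<p} \<times> Z)"
  proof (rule inj_onI)
    fix u v assume uv: "u \<in> {..<p} \<times> {..<p} \<times> Z" "v \<in> {..<p} \<times> {..<p} \<times> Z" "?f u = ?f v"
    obtain i j z i' j' z' where [simp]: "u = (i, j, z)" "v = (i', j', z')" by (metis prod_cases3)
    have b: "i < p" "j < p" "i' < p" "j' < p" and z: "z \<in> Z" "z' \<in> Z"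
      and eq: "x [^] i \<otimes> y [^] j \<otimes> z = x [^] i' \<otimes> y [^] j' \<otimes> z'" using uv by auto
    have "c [^] i = c [^] i'" using twist_unique tw(1)[OF z(1)] tw(1)[OF z(2)] eq by metis
    then have i: "i = i'" using c_pow_inj b by blast
    have "c [^] j = c [^] j'" using twist_unique tw(2)[OF z(1)] tw(2)[OF z(2)] eq by metis
    then have j: "j = j'" using c_pow_inj b by blast
    have "z \<in> carrier G" "z' \<in> carrier G" using z Z_sub H_sub by auto
    then show "u = v" using i j eq by simp
  qed
  moreover have "?f ` ({..<p} \<times> {..<p} \<times> Z) \<subseteq> H"
    using Z_sub by (auto intro!: H_mult pow_H x_in_H y_in_H)
  ultimately have "card ({..<p} \<times> {..<p} \<times> Z) \<le> card H"
    using finite_H by (rule card_inj_on_le)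
  then show ?thesis by (simp add: card_cartesian_product mult.assoc)
qed

end

section \<open>The bound for the whole group\<close>

theorem theorem4p1:
  fixes p :: nat and G :: "('a, 'b) monoid_scheme"
  assumes "Factorial_Ring.prime p"
    and "finite_p_group p G"
    and "\<not> comm_group G"
  shows "real (large_davenport G)
    \<le> (real p ^ 2 + 2 * real p - 2) / real p ^ 3 * real (order G)"
proof -
  interpret group G using assms(2) by (simp add: finite_p_group_def)
  have fin: "finite (carrier G)" using assms(2) by (simp add: finite_p_group_def)
  obtain n where n: "order G = p ^ n" using assms(2) by (auto simp: finite_p_group_def)
  obtain x y c where "twist y x c" "c \<noteq> \<one>\<^bsub>G\<^esub>" "c [^]\<^bsub>G\<^esub> p = \<one>\<^bsub>G\<^esub>"
    using p_group_exists_twist[OF assms(1) n assms(3)] by blast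
  then interpret twisted_pair G x y c p
    using fin assms(1) by unfold_locales
  define k where "k = card Z * p + 2 * p - 2"
  have "large_davenport G \<in> {size S | S. minimal_product_one G S}"
    unfolding large_davenport_def
    by (intro Max_in finite_minimal_product_one_lengths fin minimal_product_one_lengths_nonempty)
  then obtain S where S: "large_davenport G = size S" "minimal_product_one G S" by blast
  have "size S \<le> card (rcosets\<^bsub>G\<^esub> H) * k"
    unfolding k_def using minimal_product_one_size_le p_le_card_Z
    by (intro minimal_product_one_size_le_index[OF fin subgroup_H _ S(2)]) blast
  then have le: "real (size S) \<le> real (card (rcosets\<^bsub>G\<^esub> H)) * real k"
    by (metis of_nat_le_iff of_nat_mult)
  have p: "real p \<ge> 2" using p_gt_1 by simp
  have q: "real p \<le> real (card Z)" using p_le_card_Z by simp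
  have k: "real k = real (card Z) * real p + 2 * real p - 2"
    using p_gt_1 by (simp add: k_def of_nat_diff)
  \<comment> \<open>By \<open>card Z \<ge> p\<close> the constant summand \<open>2 * p - 2\<close>
    of \<open>k\<close> is at most \<open>(2 * p - 2) * card Z / p\<close>, which makes the bound
    proportional to \<open>card Z\<close>.\<close>
  have "2 * (real p - 1) * real p \<le> 2 * (real p - 1) * real (card Z)"
    using p q by (intro mult_left_mono) auto
  then have "real k * real p \<le> (real p ^ 2 + 2 * real p - 2) * real (card Z)"
    unfolding k by (simp add: algebra_simps power2_eq_square)
  \<comment> \<open>The factor \<open>p ^ 2\<close> prepares for replacing
    \<open>p * p * card Z\<close> by \<open>card H\<close>.\<close>
  then have "real k * real p * real p ^ 2 \<le> (real p ^ 2 + 2 * real p - 2) * real (card Z) * real p ^ 2"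
    by (intro mult_right_mono) auto
  also have "\<dots> = (real p ^ 2 + 2 * real p - 2) * real (p * p * card Z)"
    by (simp add: power2_eq_square)
  also have "\<dots> \<le> (real p ^ 2 + 2 * real p - 2) * real (card H)"
    using card_Z_mult_le p by (intro mult_left_mono) (simp_all only: of_nat_le_iff, simp add: add_increasing)
  finally have "real k * real p ^ 3 \<le> (real p ^ 2 + 2 * real p - 2) * real (card H)"
    by (simp add: power2_eq_square power3_eq_cube mult.assoc)
  then have "real k \<le> (real p ^ 2 + 2 * real p - 2) / real p ^ 3 * real (card H)"
    using p by (simp add: field_simps)
  then have "real (card (rcosets\<^bsub>G\<^esub> H)) * real k
      \<le> real (card (rcosets\<^bsub>G\<^esub> H)) * ((real p ^ 2 + 2 * real p - 2) / real p ^ 3 * real (card H))"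
    by (rule mult_left_mono) simp
  also have "\<dots> = (real p ^ 2 + 2 * real p - 2) / real p ^ 3 * real (card (rcosets\<^bsub>G\<^esub> H) * card H)"
    by simp
  also have "card (rcosets\<^bsub>G\<^esub> H) * card H = order G" by (rule lagrange[OF subgroup_H])
  finally show ?thesis using le S(1) by simp
qed

end
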